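(* Let $f:\mathbb R_{\ge0}\to[0,1]$ satisfy the following: - $f$ is thrice differentiable and convex; - $f'$ is log-concave, meaning $f'''(x)f'(x)\le (f''(x))^2$ for all $x\ge0$; - $\lim_{x\to\infty}f(x)=0$. Let $$\Gamma:=1-\int_0^\infty e^{-t}f(t)\,dt,$$ and let $r\ge 0$ satisfy $$r\le \frac{-f'(0)-\Gamma}{\Gamma+(1-\Gamma)f'(0)}.$$ If there is an $(f,r)$-continuous OCS, then there is a $\Gamma$-competitive algorithm for edge-weighted online bipartite matching.
   Context: Edge-weighted online bipartite matching with free disposal: offline vertices $L$ are known in advance. Online vertices $j$ arrive one at a time, and on arrival the weights $w_{ij}\ge0$ ($i\in L$) are revealed. The algorithm must irrevocably assign $j$ to at most one offline vertex before the next arrival. An offline vertex may receive several online vertices but contributes only the largest such weight. A randomized algorithm is $\Gamma$-competitive if its expected total value is at least $\Gamma$ times the optimal offline matching weight on every instance. Continuous OCS: let $L$ be a finite set of ground elements. A continuous OCS is an online randomized algorithm that at each time step $j=1,2,\dots$ receives a probability vector $p^{(j)}$ indexed by $L$ (nonnegative entries summing to $1$) and irrevocably chooses a winner in $L$. For $r\ge0$ and $f:\mathbb R_{\ge0}\to[0,1]$, a continuous OCS is an $(f,r)$-continuous OCS if there is a function $\mathcal F$ with the following three properties. $\mathcal F$ assigns a value $\mathcal F(S,q)$ to every set $S$ of time steps and every sequence $q=(q_1,q_2,\dots)$ of numbers in $[0,1]$. (a) For every element $i\in L$ and every set $S$ of time steps, the probability that $i$ never wins at a time step in $S$ is at most $\mathcal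 F(S,q)$, where $q_j=(p^{(j)})_i$. (b) Consecutive: if $S=\{j_1,\dots,j_2\}$ is a set of consecutive time steps, then $\mathcal F(S,q)\le f\big(\sum_{j\in S}q_j\big)$. (c) Partially ignore small gaps. Let $S_1,S_2\subseteq\mathbb N$ be disjoint with $j_1<j_2$ for all $j_1\in S_1$, $j_2\in S_2$, and let $j^\star$ be a time step strictly between every element of $S_1$ and every element of $S_2$. Define $$\mathrm{del}_{j^\star}(S_1\cup S_2):=S_1\cup\{j-1:j\in S_2\},$$ and let $\mathrm{del}_{j^\star}(q)_j$ equal $q_j$ for $j<j^\star$ and $q_{j+1}$ for $j\ge j^\star$. Then, with $w=(1-r\,q_{j^\star})_+$, $$\mathcal F(S_1\cup S_2,q)\le w\,\mathcal F(\mathrm{del}_{j^\star}(S_1\cup S_2),\mathrm{del}_{j^\star}(q))+(1-w)\,\mathcal F(S_1,q)\,\mathcal F(S_2,q).$$ *)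

theory Defs
  imports "HOL-Probability.Probability" "HOL-Library.Infinite_Typeclass"
begin

(* A randomized online algorithm is a family, indexed by the finite set L known in advance,
   of probability spaces M L of random seeds together with a map that takes a seed and the
   nonempty list of all inputs revealed so far (the last one being the current input) to the
   irrevocable decision made for the current input.  Decisions thus depend on the past only.
   Time steps and online vertices are numbered from 0.  Ground elements and offline vertices are
   meant to come from an infinite type, so that L takes every finite cardinality. *)

definition prob_vectors :: "'a set \<Rightarrow> ('a \<Rightarrow> real) set" where
  "prob_vectors L = {p. (\<forall>i\<in>L. 0 \<le> p i) \<and> (\<forall>i. i \<notin> L \<longrightarrow> p i = 0) \<and> (\<Sum>i\<in>L. p i) = 1}"

(* Measurability into the count space also says that the winner lies in L.  The case L = {} is
   left out because there is no probability vector on the empty set. *)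
definition continuous_OCS ::
  "('a set \<Rightarrow> 'w measure) \<Rightarrow> ('a set \<Rightarrow> 'w \<Rightarrow> ('a \<Rightarrow> real) list \<Rightarrow> 'a) \<Rightarrow> bool" where
  "continuous_OCS M A \<longleftrightarrow> (\<forall>L. finite L \<and> L \<noteq> {} \<longrightarrow>
     prob_space (M L) \<and>
     (\<forall>ps. ps \<noteq> [] \<and> set ps \<subseteq> prob_vectors L \<longrightarrow>
        (\<lambda>\<omega>. A L \<omega> ps) \<in> M L \<rightarrow>\<^sub>M count_space L))"

definition del_seq :: "nat \<Rightarrow> (nat \<Rightarrow> real) \<Rightarrow> nat \<Rightarrow> real" where
  "del_seq k q = (\<lambda>j. if j < k then q j else q (Suc j))"

definition OCS_never_wins_bound ::
  "'a set \<Rightarrow> 'w measure \<Rightarrow> ('w \<Rightarrow> ('a \<Rightarrow> real) list \<Rightarrow> 'a) \<Rightarrow>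
   (nat set \<Rightarrow> (nat \<Rightarrow> real) \<Rightarrow> real) \<Rightarrow> bool" where
  "OCS_never_wins_bound L M A F \<longleftrightarrow>
     (\<forall>p i S. (\<forall>j. p j \<in> prob_vectors L) \<and> i \<in> L \<longrightarrow>
        measure M {\<omega> \<in> space M. \<forall>j\<in>S. A \<omega> (map p [0..<Suc j]) \<noteq> i} \<le> F S (\<lambda>j. p j i))"

definition consecutive_bound ::
  "(real \<Rightarrow> real) \<Rightarrow> (nat set \<Rightarrow> (nat \<Rightarrow> real) \<Rightarrow> real) \<Rightarrow> bool" where
  "consecutive_bound f F \<longleftrightarrow>
     (\<forall>q j1 j2. (\<forall>j. q j \<in> {0..1}) \<and> j1 \<le> j2 \<longrightarrow> F {j1..j2} q \<le> f (\<Sum>j\<in>{j1..j2}. q j))"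

(* The two conditions relating k to S1 and S2 force S1 and S2 to be disjoint, with S1 before S2. *)
definition ignores_small_gaps ::
  "real \<Rightarrow> (nat set \<Rightarrow> (nat \<Rightarrow> real) \<Rightarrow> real) \<Rightarrow> bool" where
  "ignores_small_gaps r F \<longleftrightarrow>
     (\<forall>q S1 S2 k. (\<forall>j. q j \<in> {0..1}) \<and> (\<forall>j\<in>S1. j < k) \<and> (\<forall>j\<in>S2. k < j) \<longrightarrow>
        (let w = max 0 (1 - r * q k) in
           F (S1 \<union> S2) q \<le> w * F (S1 \<union> (\<lambda>j. j - 1) ` S2) (del_seq k q) + (1 - w) * (F S1 q * F S2 q)))"

definition fr_continuous_OCS ::
  "(real \<Rightarrow> real) \<Rightarrow> real \<Rightarrow> ('a set \<Rightarrow> 'w measure) \<Rightarrow>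
   ('a set \<Rightarrow> 'w \<Rightarrow> ('a \<Rightarrow> real) list \<Rightarrow> 'a) \<Rightarrow> bool" where
  "fr_continuous_OCS f r M A \<longleftrightarrow> continuous_OCS M A \<and>
     (\<forall>L. finite L \<and> L \<noteq> {} \<longrightarrow>
        (\<exists>F. OCS_never_wins_bound L (M L) (A L) F \<and> consecutive_bound f F \<and> ignores_small_gaps r F))"

(* An instance on the offline vertices L is the list of the weight vectors of the online
   vertices, in order of arrival. *)
definition weight_vectors :: "'a set \<Rightarrow> ('a \<Rightarrow> real) set" where
  "weight_vectors L = {w. (\<forall>i\<in>L. 0 \<le> w i) \<and> (\<forall>i. i \<notin> L \<longrightarrow> w i = 0)}"

definition bip_matching :: "'a set \<Rightarrow> nat \<Rightarrow> ('a \<times> nat) set \<Rightarrow> bool" where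
  "bip_matching L n E \<longleftrightarrow> E \<subseteq> L \<times> {..<n} \<and> inj_on fst E \<and> inj_on snd E"

definition opt_matching_weight :: "'a set \<Rightarrow> ('a \<Rightarrow> real) list \<Rightarrow> real" where
  "opt_matching_weight L ws =
     Max ((\<lambda>E. \<Sum>(i, j)\<in>E. (ws ! j) i) ` {E. bip_matching L (length ws) E})"

(* Value with free disposal of the deterministic online rule d, which assigns online vertex j
   to d (take (Suc j) ws), where None means that j stays unassigned. *)
definition free_disposal_value ::
  "'a set \<Rightarrow> (('a \<Rightarrow> real) list \<Rightarrow> 'a option) \<Rightarrow> ('a \<Rightarrow> real) list \<Rightarrow> real" where
  "free_disposal_value L d ws =
     (\<Sum>i\<in>L. Max (insert 0 {(ws ! j) i | j. j < length ws \<and> d (take (Suc j) ws) = Some i}))"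

definition online_matching_algorithm ::
  "('a set \<Rightarrow> 'w measure) \<Rightarrow> ('a set \<Rightarrow> 'w \<Rightarrow> ('a \<Rightarrow> real) list \<Rightarrow> 'a option) \<Rightarrow> bool" where
  "online_matching_algorithm M B \<longleftrightarrow> (\<forall>L. finite L \<longrightarrow>
     prob_space (M L) \<and>
     (\<forall>ws. ws \<noteq> [] \<and> set ws \<subseteq> weight_vectors L \<longrightarrow>
        (\<lambda>\<omega>. B L \<omega> ws) \<in> M L \<rightarrow>\<^sub>M count_space (insert None (Some ` L))))"

definition competitive_matching_algorithm ::
  "real \<Rightarrow> ('a set \<Rightarrow> 'w measure) \<Rightarrow> ('a set \<Rightarrow> 'w \<Rightarrow> ('a \<Rightarrow> real) list \<Rightarrow> 'a option) \<Rightarrow> bool" where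
  "competitive_matching_algorithm \<Gamma> M B \<longleftrightarrow> online_matching_algorithm M B \<and>
     (\<forall>L ws. finite L \<and> set ws \<subseteq> weight_vectors L \<longrightarrow>
        (\<integral>\<omega>. free_disposal_value L (B L \<omega>) ws \<partial>M L) \<ge> \<Gamma> * opt_matching_weight L ws)"

end

theory Submission
  imports Defs
begin

text \<open>
  An online primal-dual argument. Split the value of an offline vertex \<open>i\<close> into weight levels
  \<open>u > 0\<close>: at level \<open>u\<close> the vertex earns \<open>1\<close> as soon as it wins a step of weight at least \<open>u\<close>. Steps
  of smaller weight are gaps for that level. Conditions (b) and (c) bound the probability that \<open>i\<close>
  has not yet earned level \<open>u\<close> by \<open>h 0\<close>, where the state \<open>h\<close> starts as \<open>f\<close>, becomes \<open>h (q + \<cdot>)\<close> when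
  mass \<open>q\<close> is offered in a step that counts, and becomes \<open>w h + (1 - w) h(0) f\<close> with
  \<open>w = (1 - r q)\<^sub>+\<close> when it is offered in a gap.

  Put \<open>b(h) = h(0) - \<integral> e\<^sup>-\<^sup>t h(t) dt\<close>, so that \<open>b(f) = \<Gamma>\<close>, and give the level the dual value
  \<open>\<Gamma> - b(h)\<close>. Offering mass \<open>q\<close> in a step of weight \<open>v\<close> leaves, at each level \<open>u \<le> v\<close>, a surplus of
  \<open>\<integral> e\<^sup>-\<^sup>t (h(t) - h(q + t)) dt\<close>, which is concave in \<open>q\<close> with derivative \<open>b(h(q + \<cdot>))\<close>, while at each
  level \<open>u > v\<close> it costs at most \<open>r q (b(h) - h(0) \<Gamma>)\<close>. Maximising the total surplus over all
  probability vectors gives a dual value of the online vertex that is at least the marginal price at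
  every \<open>i\<close>. Together with the dual value of \<open>i\<close> this covers \<open>\<Gamma> v\<close>, provided that
  \<open>r (b(h) - h(0) \<Gamma>) \<le> \<Gamma> - b(h)\<close> at all reachable states. That inequality is an equality at \<open>h = f\<close>,
  is preserved by gaps because \<open>f(x + y) \<le> f(x) f(y)\<close>, and is preserved by advances because of the
  hypothesis on \<open>r\<close> and the log-concavity of \<open>f'\<close>.
\<close>

section \<open>Exponential means\<close>

definition advance :: "real \<Rightarrow> (real \<Rightarrow> real) \<Rightarrow> real \<Rightarrow> real" where
  "advance x h = (\<lambda>y. h (x + y))"

definition exp_mean :: "(real \<Rightarrow> real) \<Rightarrow> real" where
  "exp_mean h = integral {0..} (\<lambda>t. exp (- t) * h t)"

text \<open>The exponential mean of the decrement \<open>h 0 - h t\<close>. Along advances of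
  \<open>h\<close> it is also minus the derivative of the exponential mean; at \<open>f\<close> it
  is the competitive ratio.\<close>

definition exp_drop :: "(real \<Rightarrow> real) \<Rightarrow> real" where
  "exp_drop h = h 0 - exp_mean h"

lemma advance_0 [simp]: "advance 0 h = h"
  by (simp add: advance_def)

lemma advance_advance [simp]: "advance x (advance y h) = advance (y + x) h"
  by (simp add: advance_def add.assoc)

lemma advance_at_0 [simp]: "advance x h 0 = h x"
  by (simp add: advance_def)

lemma has_integral_exp_minus: "((\<lambda>t::real. exp (- t)) has_integral 1) {0..}"
  using has_integral_exp_minus_to_infinity[of 1 0] by simp

lemma integrable_exp_minus: "(\<lambda>t::real. exp (- t) * c) integrable_on {0..}"
  using has_integral_mult_left[OF has_integral_exp_minus] by blast

lemma set_integrable_exp_minus_mult: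
  fixes h :: "real \<Rightarrow> real"
  assumes cont: "continuous_on {0..} h" and bound: "\<And>x. 0 \<le> x \<Longrightarrow> \<bar>h x\<bar> \<le> 1"
  shows "set_integrable lborel {0..} (\<lambda>t. exp (- t) * h t)"
proof -
  have e: "set_integrable lborel {0..} (\<lambda>t::real. exp (- t))"
  proof -
    have "(\<lambda>t::real. exp (- t)) absolutely_integrable_on {0..}"
      by (intro nonnegative_absolutely_integrable_1)
        (use has_integral_exp_minus in auto)
    \<comment> \<open>Absolute integrability lives on the completed measure; Borel measurability of
      the integrand brings it down to \<open>lborel\<close>.\<close>
    then show ?thesis
      unfolding set_integrable_def
      by (rule integrable_completion[THEN iffD1, rotated]) 
        (auto intro!: borel_measurable_indicator borel_measurable_continuous_onI continuous_intros)
  qed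
  show ?thesis
  proof (rule set_integrable_bound[OF e])
    show "set_borel_measurable lborel {0..} (\<lambda>t. exp (- t) * h t)"
      unfolding set_borel_measurable_def
      using borel_measurable_continuous_on_indicator[of "{0..}" "\<lambda>t. exp (- t) * h t"] cont
      by (simp add: continuous_intros)
    show "AE x in lborel. x \<in> {0..} \<longrightarrow> norm (exp (- x) * h x) \<le> norm (exp (- x))"
      using bound by (auto simp: abs_mult mult_left_le)
  qed
qed

lemma exp_minus_mult_integrable_on:
  fixes h :: "real \<Rightarrow> real"
  assumes "continuous_on {0..} h" and "\<And>x. 0 \<le> x \<Longrightarrow> \<bar>h x\<bar> \<le> 1"
  shows "(\<lambda>t. exp (- t) * h t) integrable_on {0..}"
  using set_borel_integral_eq_integral(1)[OF set_integrable_exp_minus_mult] assms by blast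

section \<open>Exponential means of advanced functions\<close>

lemma continuous_on_advance:
  assumes "continuous_on {0..} h" "0 \<le> x"
  shows "continuous_on {0..} (advance x h)"
  unfolding advance_def
  by (rule continuous_on_compose2[OF assms(1)]) (use assms(2) in \<open>auto intro!: continuous_intros\<close>)

text \<open>Splitting the integral at \<open>x\<close> and shifting the upper part isolates the
  dependence on \<open>x\<close> in a closed form to which the fundamental theorem of calculus
  applies.\<close>

lemma exp_mean_advance:
  assumes cont: "continuous_on {0..} h" and bound: "\<And>x. 0 \<le> x \<Longrightarrow> \<bar>h x\<bar> \<le> 1" and "0 \<le> x"
  shows "exp_mean (advance x h) = exp x * (exp_mean h - integral {0..x} (\<lambda>t. exp (- t) * h t))"
proof -
  let ?g = "\<lambda>t. exp (- t) * h t"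
  have ig: "set_integrable lborel {0..} ?g"
    using set_integrable_exp_minus_mult cont bound by blast
  have ix: "set_integrable lborel {x..} ?g"
    by (rule set_integrable_subset[OF ig]) (use \<open>0 \<le> x\<close> in auto)
  have ia: "set_integrable lborel {0..} (\<lambda>t. exp (- t) * advance x h t)"
    by (rule set_integrable_exp_minus_mult)
      (use continuous_on_advance[OF cont \<open>0 \<le> x\<close>] bound \<open>0 \<le> x\<close> in \<open>auto simp: advance_def\<close>)
  have "integral {x..} ?g = (LINT t:{x..}|lborel. ?g t)"
    using set_borel_integral_eq_integral(2)[OF ix] by simp
  also have "\<dots> = (LINT t|lborel. indicator {x..} (x + 1 * t) *\<^sub>R ?g (x + 1 * t))"
    unfolding set_lebesgue_integral_def
    using lborel_integral_real_affine[of 1 "\<lambda>t. indicator {x..} t *\<^sub>R ?g t" x] by simp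
  also have "\<dots> = (LINT t|lborel. exp (- x) * (indicator {0..} t *\<^sub>R (exp (- t) * advance x h t)))"
    by (intro Bochner_Integration.integral_cong)
      (auto simp: advance_def indicator_def exp_add[symmetric] algebra_simps)
  also have "\<dots> = exp (- x) * exp_mean (advance x h)"
    using set_borel_integral_eq_integral(2)[OF ia]
    by (simp add: exp_mean_def set_lebesgue_integral_def)
  finally have 1: "integral {x..} ?g = exp (- x) * exp_mean (advance x h)" .
  have "integral ({0..x} \<union> {x..}) ?g = integral {0..x} ?g + integral {x..} ?g"
  proof (rule integral_Un)
    show "?g integrable_on {0..x}"
      by (rule integrable_continuous_interval) (intro continuous_intros continuous_on_subset[OF cont], auto)
    show "?g integrable_on {x..}"
      using set_borel_integral_eq_integral(1)[OF ix] .
    have "{0..x} \<inter> {x..} = {x}" using \<open>0 \<le> x\<close> by auto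
    then show "negligible ({0..x} \<inter> {x..})" by simp
  qed
  moreover have "{0..x} \<union> {x..} = {0..}" using \<open>0 \<le> x\<close> by auto
  ultimately have "exp_mean h = integral {0..x} ?g + exp (- x) * exp_mean (advance x h)"
    unfolding exp_mean_def using 1 by (simp add: exp_mean_def)
  then show ?thesis
    by (simp add: exp_minus field_simps)
qed

text \<open>Product rule on the closed form: the factor \<open>exp x\<close> reproduces the mean
  itself, and the moving end point contributes \<open>- h x\<close>.\<close>

lemma exp_mean_advance_has_derivative:
  assumes cont: "continuous_on {0..} h" and bound: "\<And>x. 0 \<le> x \<Longrightarrow> \<bar>h x\<bar> \<le> 1" and "0 < x"
  shows "((\<lambda>x. exp_mean (advance x h)) has_real_derivative - exp_drop (advance x h)) (at x)"
proof -
  let ?g = "\<lambda>t. exp (- t) * h t"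
  have "((\<lambda>y. integral {0..y} ?g) has_real_derivative ?g x) (at x within {0..x+1})"
    by (rule integral_has_real_derivative)
      (use \<open>0 < x\<close> in \<open>auto intro!: continuous_intros continuous_on_subset[OF cont]\<close>)
  then have "((\<lambda>y. integral {0..y} ?g) has_real_derivative ?g x) (at x)"
    using \<open>0 < x\<close> by (subst (asm) at_within_interior) auto
  then have "((\<lambda>y. exp y * (exp_mean h - integral {0..y} ?g)) has_real_derivative
      exp x * (exp_mean h - integral {0..x} ?g) + (0 - ?g x) * exp x) (at x)"
    by (auto intro!: derivative_eq_intros)
  also have "exp x * (exp_mean h - integral {0..x} ?g) + (0 - ?g x) * exp x = - exp_drop (advance x h)"
    using exp_mean_advance[OF cont bound, of x] \<open>0 < x\<close>
    by (simp add: exp_drop_def exp_minus field_simps)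
  finally show ?thesis
    by (rule has_field_derivative_transform_within_open[of _ _ _ "{0<..}"])
      (use exp_mean_advance[OF cont bound] \<open>0 < x\<close> in auto)
qed

lemma continuous_on_exp_mean_advance:
  assumes cont: "continuous_on {0..} h" and bound: "\<And>x. 0 \<le> x \<Longrightarrow> \<bar>h x\<bar> \<le> 1"
  shows "continuous_on {0..x} (\<lambda>x. exp_mean (advance x h))"
proof -
  have "continuous_on {0..x} (\<lambda>x. exp x * (exp_mean h - integral {0..x} (\<lambda>t. exp (- t) * h t)))"
    by (intro continuous_intros indefinite_integral_continuous_1 integrable_continuous_interval
        continuous_on_subset[OF cont]) auto
  then show ?thesis
    by (rule continuous_on_eq) (use exp_mean_advance[OF cont bound] in auto)
qed

lemma exp_mean_mono:
  assumes "(\<lambda>t. exp (- t) * h t) integrable_on {0..}" "(\<lambda>t. exp (- t) * k t) integrable_on {0..}"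
    and "\<And>t. 0 \<le> t \<Longrightarrow> h t \<le> k t"
  shows "exp_mean h \<le> exp_mean k"
  unfolding exp_mean_def by (rule integral_le) (use assms in auto)

lemma exp_mean_const: "exp_mean (\<lambda>_. c) = c"
  using has_integral_mult_left[OF has_integral_exp_minus, of c]
  unfolding exp_mean_def by (intro integral_unique) simp

lemma exp_mean_cmult: "exp_mean (\<lambda>t. c * h t) = c * exp_mean h"
  unfolding exp_mean_def by (subst integral_mult_right[symmetric]) (simp add: mult.left_commute)

lemma exp_mean_add:
  assumes "(\<lambda>t. exp (- t) * h t) integrable_on {0..}" "(\<lambda>t. exp (- t) * k t) integrable_on {0..}"
  shows "exp_mean (\<lambda>t. a * h t + b * k t) = a * exp_mean h + b * exp_mean k"
proof -
  have "exp_mean (\<lambda>t. a * h t + b * k t) =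
      integral {0..} (\<lambda>t. a * (exp (- t) * h t) + b * (exp (- t) * k t))"
    unfolding exp_mean_def by (rule integral_cong) (simp add: algebra_simps)
  also have "\<dots> = a * exp_mean h + b * exp_mean k"
    unfolding exp_mean_def using assms
    by (subst integral_add) (auto intro: integrable_on_mult_right)
  finally show ?thesis .
qed

lemma exp_drop_eq_mean:
  assumes "continuous_on {0..} h" and "\<And>x. 0 \<le> x \<Longrightarrow> \<bar>h x\<bar> \<le> 1"
  shows "exp_drop h = exp_mean (\<lambda>t. h 0 - h t)"
proof -
  have "exp_mean (\<lambda>t. h 0 * 1 + (- 1) * h t) = h 0 * exp_mean (\<lambda>_. 1) + (- 1) * exp_mean h"
    by (rule exp_mean_add[OF integrable_exp_minus exp_minus_mult_integrable_on[OF assms]])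
  then show ?thesis
    by (simp add: exp_drop_def exp_mean_const)
qed

lemma exp_diff_integrable:
  fixes h :: "real \<Rightarrow> real"
  assumes "continuous_on {0..} h" and "\<And>x. 0 \<le> x \<Longrightarrow> \<bar>h x\<bar> \<le> 1"
  shows "(\<lambda>t. exp (- t) * (h 0 - h t)) integrable_on {0..}"
  unfolding right_diff_distrib
  by (rule integrable_diff[OF integrable_exp_minus exp_minus_mult_integrable_on[OF assms]])

lemma convex_on_advance:
  assumes "convex_on {0..} h" "0 \<le> x"
  shows "convex_on {0..} (advance x h)"
proof (rule convex_onI)
  fix t y z :: real
  assume "0 < t" "t < 1" "y \<in> {0..}" "z \<in> {0..}"
  moreover have "x + ((1 - t) * y + t * z) = (1 - t) * (x + y) + t * (x + z)"
    by (simp add: algebra_simps)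
  ultimately show "advance x h ((1 - t) *\<^sub>R y + t *\<^sub>R z) \<le> (1 - t) * advance x h y + t * advance x h z"
    using convex_onD[OF assms(1), of t "x + y" "x + z"] \<open>0 \<le> x\<close> by (simp add: advance_def)
qed simp

text \<open>Both \<open>x\<close> and \<open>t\<close> are convex combinations of \<open>0\<close>
  and \<open>x + t\<close>, with complementary weights; the two convexity inequalities add up to the
  claim. It makes \<open>exp_drop\<close> decrease along advances.\<close>

lemma convex_diff_mono:
  fixes h :: "real \<Rightarrow> real"
  assumes "convex_on {0..} h" "0 \<le> x" "0 \<le> t"
  shows "h x - h (x + t) \<le> h 0 - h t"
proof (cases "x + t = 0")
  case False
  let ?s = "x / (x + t)"
  have s: "0 \<le> ?s" "?s \<le> 1" "1 - ?s = t / (x + t)" using assms False by (auto simp: field_simps)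
  have "h ((1 - ?s) * 0 + ?s * (x + t)) \<le> (1 - ?s) * h 0 + ?s * h (x + t)"
    using convex_onD[OF assms(1), of ?s 0 "x + t"] s assms by simp
  moreover have "h ((1 - (1 - ?s)) * 0 + (1 - ?s) * (x + t)) \<le> (1 - (1 - ?s)) * h 0 + (1 - ?s) * h (x + t)"
    using convex_onD[OF assms(1), of "1 - ?s" 0 "x + t"] s assms by simp
  moreover have "?s * (x + t) = x" "(1 - ?s) * (x + t) = t" using False s(3) by auto
  ultimately have "h x + h t \<le> h 0 + h (x + t)" by (simp add: algebra_simps)
  then show ?thesis by simp
next
  case True
  then have "x = 0" "t = 0" using assms by linarith+
  then show ?thesis by simp
qed

section \<open>States of a level\<close>

text \<open>What the primal-dual argument uses about the rate. It is instantiated with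
  \<open>K = - f' 0\<close>; the upper bound on \<open>r\<close> enters through
  \<open>f_slack_mono\<close> alone.\<close>

locale ocs_rate =
  fixes f :: "real \<Rightarrow> real" and r K :: real
  assumes f_0: "f 0 = 1"
    and f_nonneg: "0 \<le> x \<Longrightarrow> 0 \<le> f x"
    and f_cont: "continuous_on {0..} f"
    and f_convex: "convex_on {0..} f"
    and f_le_1: "0 \<le> x \<Longrightarrow> f x \<le> 1"
    and f_submult: "0 \<le> x \<Longrightarrow> 0 \<le> y \<Longrightarrow> f (x + y) \<le> f x * f y"
    and f_lipschitz: "0 \<le> x \<Longrightarrow> 0 \<le> y \<Longrightarrow> f x - f (x + y) \<le> K * y"
    and r_nonneg: "0 \<le> r"
    and K_nonneg: "0 \<le> K"
    and f_slack_mono: "0 \<le> x \<Longrightarrow> x \<le> y \<Longrightarrow>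
      r * exp_drop f * f x - (1 + r) * exp_drop (advance x f) \<le>
      r * exp_drop f * f y - (1 + r) * exp_drop (advance y f)"
begin

text \<open>The inequality \<open>r * (exp_drop h - h 0 * exp_drop f) \<le> exp_drop f - exp_drop
  h\<close> rearranges to \<open>0 \<le> exp_drop f + slack h 0\<close>; the argument
  \<open>x\<close> refers to the state \<open>advance x h\<close>.\<close>

definition slack :: "(real \<Rightarrow> real) \<Rightarrow> real \<Rightarrow> real" where
  "slack h x = r * exp_drop f * h x - (1 + r) * exp_drop (advance x h)"

definition keep :: "real \<Rightarrow> real" where
  "keep q = max 0 (1 - r * q)"

definition gap :: "real \<Rightarrow> (real \<Rightarrow> real) \<Rightarrow> real \<Rightarrow> real" where
  "gap q h = (\<lambda>y. keep q * h y + (1 - keep q) * (h 0 * f y))"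

text \<open>A state \<open>h\<close> bounds the probability that an element has not yet won: \<open>h y\<close> is the bound
  after a further mass \<open>y\<close> has been offered in consecutive steps. Offering mass \<open>q\<close> in a relevant
  step turns \<open>h\<close> into \<open>advance q h\<close>, offering it in an irrelevant one turns \<open>h\<close> into \<open>gap q h\<close>
  (condition (c) of an OCS). The last condition says that the dual value \<open>exp_drop f - exp_drop h\<close>
  covers the marginal loss \<open>r * (exp_drop h - h 0 * exp_drop f)\<close> caused by a gap; the
  monotonicity of \<open>slack\<close>, which rests on the upper bound on \<open>r\<close>, keeps it true under advances.\<close>
definition good :: "(real \<Rightarrow> real) \<Rightarrow> bool" where
  "good h \<longleftrightarrow> continuous_on {0..} h \<and> convex_on {0..} h \<and> (\<forall>x\<ge>0. 0 \<le> h x) \<and> h 0 \<le> 1 \<and>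
     (\<forall>x\<ge>0. \<forall>y\<ge>0. h (x + y) \<le> h x * f y) \<and> (\<forall>x\<ge>0. \<forall>y\<ge>0. h x - h (x + y) \<le> K * y) \<and>
     (\<forall>x\<ge>0. \<forall>y\<ge>x. slack h x \<le> slack h y) \<and> 0 \<le> exp_drop f + slack h 0"

lemma keep_nonneg: "0 \<le> keep q" and keep_le_1: "0 \<le> q \<Longrightarrow> keep q \<le> 1"
  and one_minus_keep: "1 - keep q \<le> r * q"
  using r_nonneg by (auto simp: keep_def)

lemma gap_at_0 [simp]: "gap q h 0 = h 0"
  by (simp add: gap_def f_0 algebra_simps)

text \<open>As \<open>f 0 = 1\<close>, both parts of the mixture are multiples of \<open>f\<close>.
  So gaps before the first step that counts leave a level unchanged.\<close>

lemma gap_f [simp]: "gap q f = f"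
  by (simp add: gap_def f_0 algebra_simps)

lemma good_f: "good f"
proof -
  have "0 \<le> exp_drop f + slack f 0"
    by (simp add: slack_def f_0 distrib_right)
  then show ?thesis
    unfolding good_def slack_def
    by (intro conjI allI impI f_cont f_convex f_nonneg f_submult f_lipschitz f_slack_mono) (simp_all add: f_0)
qed

lemma goodD:
  assumes "good h"
  shows "continuous_on {0..} h" "convex_on {0..} h" "h 0 \<le> 1"
    and "0 \<le> x \<Longrightarrow> 0 \<le> h x"
    and "0 \<le> x \<Longrightarrow> 0 \<le> y \<Longrightarrow> h (x + y) \<le> h x * f y"
    and "0 \<le> x \<Longrightarrow> 0 \<le> y \<Longrightarrow> h x - h (x + y) \<le> K * y"
    and "0 \<le> x \<Longrightarrow> x \<le> y \<Longrightarrow> slack h x \<le> slack h y"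
    and "0 \<le> exp_drop f + slack h 0"
  using assms unfolding good_def by simp_all

lemma good_antimono: "good h \<Longrightarrow> 0 \<le> x \<Longrightarrow> 0 \<le> y \<Longrightarrow> h (x + y) \<le> h x"
  using goodD(4)[of h x] goodD(5)[of h x y] f_le_1[of y]
  by (smt (verit) mult_left_le)

lemma good_bound: "good h \<Longrightarrow> 0 \<le> x \<Longrightarrow> \<bar>h x\<bar> \<le> 1"
  using good_antimono[of h 0 x] goodD(3)[of h] goodD(4)[of h x] by simp

lemma good_integrable:
  assumes "good h"
  shows "(\<lambda>t. exp (- t) * h t) integrable_on {0..}"
proof (rule exp_minus_mult_integrable_on)
  show "continuous_on {0..} h" using goodD(1) assms .
  show "\<bar>h x\<bar> \<le> 1" if "0 \<le> x" for x using good_bound assms that .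
qed

text \<open>Advancing shifts the argument of \<open>slack\<close>, so its monotonicity transports
  the sign condition from \<open>0\<close> to \<open>x\<close>.\<close>

lemma good_advance:
  assumes h: "good h" and x: "0 \<le> x"
  shows "good (advance x h)"
proof -
  have "slack (advance x h) y = slack h (x + y)" for y
    by (simp add: slack_def advance_def add.assoc)
  moreover have "0 \<le> exp_drop f + slack h x"
    using goodD(7)[OF h, of 0 x] goodD(8)[OF h] x by simp
  ultimately show ?thesis
    unfolding good_def
    using continuous_on_advance[OF goodD(1)[OF h] x] convex_on_advance[OF goodD(2)[OF h] x]
      goodD(4-7)[OF h] good_bound[OF h x] x
    by (auto simp: advance_def add.assoc[symmetric] abs_le_iff)
qed

lemma exp_drop_gap:
  assumes "good h"
  shows "exp_drop (gap q h) = keep q * exp_drop h + (1 - keep q) * (h 0 * exp_drop f)"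
proof -
  have "exp_mean (gap q h) = keep q * exp_mean h + ((1 - keep q) * h 0) * exp_mean f"
    unfolding gap_def
    using exp_mean_add[OF good_integrable[OF assms] good_integrable[OF good_f], of "keep q" "(1 - keep q) * h 0"]
    by (simp add: mult.assoc)
  then show ?thesis
    by (simp add: exp_drop_def f_0 algebra_simps)
qed

lemma exp_drop_eq:
  assumes "good h"
  shows "exp_drop h = exp_mean (\<lambda>t. h 0 - h t)"
  by (rule exp_drop_eq_mean[OF goodD(1)[OF assms] good_bound[OF assms]])

lemma good_diff_integrable:
  assumes "good h"
  shows "(\<lambda>t. exp (- t) * (h 0 - h t)) integrable_on {0..}"
  by (rule exp_diff_integrable[OF goodD(1)[OF assms] good_bound[OF assms]])

text \<open>The bound \<open>h t \<le> h 0 * f t\<close> of a good state passes to the means. Hence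
  a gap never raises \<open>exp_drop\<close>.\<close>

lemma exp_drop_ge:
  assumes "good h"
  shows "h 0 * exp_drop f \<le> exp_drop h"
proof -
  have "(\<lambda>t. exp (- t) * (h 0 * f t)) integrable_on {0..}"
    using integrable_on_mult_right[OF good_integrable[OF good_f], of "h 0"]
    by (simp only: mult.left_commute)
  then have "exp_mean h \<le> exp_mean (\<lambda>t. h 0 * f t)"
    by (rule exp_mean_mono[OF good_integrable[OF assms]]) (use goodD(5)[OF assms, of 0] in auto)
  also have "\<dots> = h 0 * exp_mean f"
    by (rule exp_mean_cmult)
  finally show ?thesis
    by (simp add: exp_drop_def f_0 algebra_simps)
qed

lemma exp_drop_nonneg:
  assumes "good h"
  shows "0 \<le> exp_drop h"
proof -
  have "exp_mean h \<le> exp_mean (\<lambda>t. h 0)"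
    by (rule exp_mean_mono)
      (use good_integrable[OF assms] good_antimono[OF assms, of 0] integrable_exp_minus in auto)
  then show ?thesis
    by (simp add: exp_drop_def exp_mean_const)
qed

text \<open>\<open>gap q h\<close> combines \<open>h\<close> and \<open>f\<close> with nonnegative
  weights of sum at most \<open>1\<close>, and all conditions but the last survive such
  combinations. For the last one, a gap keeps \<open>h 0\<close> and does not raise
  \<open>exp_drop\<close>, so \<open>slack\<close> at \<open>0\<close> cannot fall.\<close>

lemma good_gap:
  assumes h: "good h" and q: "0 \<le> q"
  shows "good (gap q h)"
proof -
  let ?w = "keep q" and ?c = "(1 - keep q) * h 0"
  have w: "0 \<le> ?w" "?w \<le> 1" and c: "0 \<le> ?c" and h0: "0 \<le> h 0" "h 0 \<le> 1"
    using keep_nonneg keep_le_1[OF q] goodD(3)[OF h] goodD(4)[OF h, of 0] by auto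
  have wc: "?w + ?c \<le> 1"
    using mult_left_mono[OF h0(2), of "1 - ?w"] w by simp
  have gap: "gap q h = (\<lambda>y. ?w * h y + ?c * f y)"
    by (simp add: gap_def mult.assoc)
  have slack: "slack (gap q h) x = ?w * slack h x + ?c * slack f x" if "0 \<le> x" for x
  proof -
    have "advance x (gap q h) = (\<lambda>t. ?w * advance x h t + ?c * advance x f t)"
      by (simp add: gap advance_def)
    then have A: "exp_mean (advance x (gap q h)) = ?w * exp_mean (advance x h) + ?c * exp_mean (advance x f)"
      using good_integrable[OF good_advance[OF h that]] good_integrable[OF good_advance[OF good_f that]]
      by (simp add: exp_mean_add)
    have B: "gap q h x = ?w * h x + ?c * f x"
      by (simp add: gap)
    show ?thesis
      unfolding slack_def exp_drop_def[of "advance x _"] advance_at_0 A B by (simp add: algebra_simps)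
  qed
  show ?thesis
    unfolding good_def
  proof (intro conjI allI impI)
    show "continuous_on {0..} (gap q h)"
      unfolding gap by (intro continuous_intros goodD(1) h f_cont)
    show "convex_on {0..} (gap q h)"
      unfolding gap by (intro convex_on_add convex_on_cmul goodD(2) h f_convex w c)
    show "gap q h 0 \<le> 1" using h0 by simp
    show "0 \<le> gap q h x" if "0 \<le> x" for x
      unfolding gap using goodD(4)[OF h that] f_nonneg[OF that] w c by simp
    show "gap q h (x + y) \<le> gap q h x * f y" if "0 \<le> x" "0 \<le> y" for x y
      unfolding gap using mult_left_mono[OF goodD(5)[OF h that] w(1)] mult_left_mono[OF f_submult[OF that] c]
      by (simp add: algebra_simps)
    show "gap q h x - gap q h (x + y) \<le> K * y" if "0 \<le> x" "0 \<le> y" for x y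
    proof -
      have "gap q h x - gap q h (x + y) = ?w * (h x - h (x + y)) + ?c * (f x - f (x + y))"
        unfolding gap by (simp add: algebra_simps)
      also have "\<dots> \<le> ?w * (K * y) + ?c * (K * y)"
        by (intro add_mono mult_left_mono goodD(6) f_lipschitz h w c that)
      also have "\<dots> = (?w + ?c) * (K * y)" by (simp add: algebra_simps)
      also have "\<dots> \<le> 1 * (K * y)"
        using wc K_nonneg that by (intro mult_right_mono) auto
      finally show ?thesis by simp
    qed
    show "slack (gap q h) x \<le> slack (gap q h) y" if "0 \<le> x" "x \<le> y" for x y
      using that slack[of x] slack[of y] goodD(7)[OF h that] goodD(7)[OF good_f that] w c
      by (auto intro!: add_mono mult_left_mono)
    have "exp_drop (gap q h) \<le> exp_drop h"
      using mult_left_mono[OF exp_drop_ge[OF h], of "1 - ?w"] w by (simp add: exp_drop_gap[OF h] algebra_simps)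
    then have "slack h 0 \<le> slack (gap q h) 0"
      using r_nonneg by (simp add: slack_def mult_left_mono)
    then show "0 \<le> exp_drop f + slack (gap q h) 0"
      using goodD(8)[OF h] by simp
  qed
qed

lemma exp_drop_gap_le:
  assumes h: "good h" and q: "0 \<le> q"
  shows "exp_drop (gap q h) \<le> exp_drop h"
    and "exp_drop h - exp_drop (gap q h) \<le> r * q * (exp_drop h - h 0 * exp_drop f)"
proof -
  have eq: "exp_drop h - exp_drop (gap q h) = (1 - keep q) * (exp_drop h - h 0 * exp_drop f)"
    by (simp add: exp_drop_gap[OF h] algebra_simps)
  have "0 \<le> (1 - keep q) * (exp_drop h - h 0 * exp_drop f)"
    using keep_le_1[OF q] exp_drop_ge[OF h] by simp
  with eq show "exp_drop (gap q h) \<le> exp_drop h" by linarith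
  show "exp_drop h - exp_drop (gap q h) \<le> r * q * (exp_drop h - h 0 * exp_drop f)"
    unfolding eq using one_minus_keep exp_drop_ge[OF h] by (intro mult_right_mono) auto
qed

lemma gap_cost_le:
  assumes h: "good h"
  shows "r * (exp_drop h - h 0 * exp_drop f) \<le> exp_drop f - exp_drop h"
  using goodD(8)[OF h] by (simp add: slack_def algebra_simps)

lemma exp_drop_advance_le:
  assumes h: "good h" and x: "0 \<le> x"
  shows "exp_drop (advance x h) \<le> exp_drop h"
  unfolding exp_drop_eq[OF h] exp_drop_eq[OF good_advance[OF h x]]
  by (rule exp_mean_mono[OF good_diff_integrable[OF good_advance[OF h x]] good_diff_integrable[OF h]])
    (use convex_diff_mono[OF goodD(2)[OF h] x] in \<open>auto simp: advance_def\<close>)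

lemma exp_drop_advance_antimono:
  assumes h: "good h" and "0 \<le> x" "x \<le> y"
  shows "exp_drop (advance y h) \<le> exp_drop (advance x h)"
  using exp_drop_advance_le[OF good_advance[OF h \<open>0 \<le> x\<close>], of "y - x"] assms by simp

text \<open>Mean value theorem: the slope is minus an intermediate value of \<open>exp_drop\<close>,
  which decreases along advances. This is the concavity of the surplus in the offered mass, with
  \<open>exp_drop\<close> as supergradient.\<close>

lemma exp_mean_advance_bounds:
  assumes h: "good h" and "0 \<le> x" "x \<le> y"
  shows "(y - x) * exp_drop (advance y h) \<le> exp_mean (advance x h) - exp_mean (advance y h)"
    and "exp_mean (advance x h) - exp_mean (advance y h) \<le> (y - x) * exp_drop (advance x h)"
proof -
  have "exp_mean (advance x h) - exp_mean (advance y h) \<in>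
      {(y - x) * exp_drop (advance y h)..(y - x) * exp_drop (advance x h)}"
  proof (cases "x = y")
    case False
    with assms have "x < y" by simp
    obtain z where z: "x < z" "z < y" and eq:
        "exp_mean (advance y h) - exp_mean (advance x h) = (y - x) * (- exp_drop (advance z h))"
    proof (rule mvt[OF \<open>x < y\<close>, of "\<lambda>x. exp_mean (advance x h)" "\<lambda>x d. d * (- exp_drop (advance x h))"])
      show "continuous_on {x..y} (\<lambda>x. exp_mean (advance x h))"
        by (rule continuous_on_subset[OF continuous_on_exp_mean_advance[OF goodD(1)[OF h] good_bound[OF h], of y]])
          (use assms in auto)
      show "((\<lambda>x. exp_mean (advance x h)) has_derivative (\<lambda>d. d * - exp_drop (advance u h))) (at u)"
        if "x < u" "u < y" for u
      proof -
        have "(\<lambda>d. d * - exp_drop (advance u h)) = (*) (- exp_drop (advance u h))"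
          by (simp add: fun_eq_iff)
        then show ?thesis
          using exp_mean_advance_has_derivative[OF goodD(1)[OF h] good_bound[OF h], of u] that assms
          by (simp add: has_field_derivative_def)
      qed
    qed blast
    have "exp_drop (advance y h) \<le> exp_drop (advance z h)" "exp_drop (advance z h) \<le> exp_drop (advance x h)"
      using exp_drop_advance_antimono[OF h] z assms by auto
    then have "(y - x) * exp_drop (advance y h) \<le> (y - x) * exp_drop (advance z h)"
      "(y - x) * exp_drop (advance z h) \<le> (y - x) * exp_drop (advance x h)"
      using \<open>x < y\<close> by (auto intro: mult_left_mono)
    then show ?thesis using eq by simp
  next
    case True
    then show ?thesis by simp
  qed
  then show "(y - x) * exp_drop (advance y h) \<le> exp_mean (advance x h) - exp_mean (advance y h)"
    "exp_mean (advance x h) - exp_mean (advance y h) \<le> (y - x) * exp_drop (advance x h)" by auto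
qed

text \<open>The exponential mean also decreases along advances, so \<open>exp_drop\<close> falls by
  at most as much as \<open>h\<close> itself.\<close>

lemma exp_drop_advance_lipschitz:
  assumes h: "good h" and "0 \<le> x" "x \<le> y"
  shows "exp_drop (advance x h) - exp_drop (advance y h) \<le> K * (y - x)"
proof -
  have "0 \<le> (y - x) * exp_drop (advance y h)"
    using exp_drop_nonneg[OF good_advance[OF h, of y]] assms by simp
  then have "exp_mean (advance y h) \<le> exp_mean (advance x h)"
    using exp_mean_advance_bounds(1)[OF assms] by linarith
  then show ?thesis
    using goodD(6)[OF h, of x "y - x"] assms by (simp add: exp_drop_def)
qed

end

section \<open>Log-concave rates\<close>

lemma exp_mean_ident_mult: "exp_mean (\<lambda>t. c * t) = c"
  and integrable_exp_ident: "(\<lambda>t::real. exp (- t) * (c * t)) integrable_on {0..}"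
proof -
  have "((\<lambda>t::real. exp (- t) * t) has_integral 1) {0..}"
  proof (rule has_integral_to_inf)
    have "((\<lambda>t. exp (- t) * t) has_integral (- (y + 1) * exp (- y) - (- (0 + 1) * exp (- 0)))) {0..y}"
      if "y \<ge> 0" for y :: real
      using that by (intro fundamental_theorem_of_calculus)
        (auto intro!: derivative_eq_intros simp: algebra_simps simp flip: has_real_derivative_iff_has_vector_derivative)
    then have "integral {0..y} (\<lambda>t. exp (- t) * t) = 1 - (y + 1) * exp (- y)" if "y \<ge> 0" for y :: real
      using that by (fastforce simp: algebra_simps dest: integral_unique)
    then have "\<forall>\<^sub>F y in at_top. integral {0..y} (\<lambda>t. exp (- t) * t) = 1 - (y + 1) * exp (- y :: real)"
      by (rule eventually_at_top_linorderI)
    moreover have "((\<lambda>y::real. 1 - (y + 1) * exp (- y)) \<longlongrightarrow> 1) at_top"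
      by real_asymp
    ultimately show "((\<lambda>y. integral {0..y} (\<lambda>t::real. exp (- t) * t)) \<longlongrightarrow> 1) at_top"
      by (simp add: filterlim_cong)
  qed (auto intro!: integrable_continuous_interval continuous_intros)
  then have "((\<lambda>t::real. exp (- t) * (c * t)) has_integral c) {0..}"
    using has_integral_mult_right[of _ 1 "{0..}" c] by (simp add: mult.left_commute)
  then show "exp_mean (\<lambda>t. c * t) = c" "(\<lambda>t::real. exp (- t) * (c * t)) integrable_on {0..}"
    unfolding exp_mean_def by (auto intro: integral_unique)
qed

locale log_concave_rate =
  fixes f f' f'' f''' :: "real \<Rightarrow> real"
  assumes f_range: "x \<ge> 0 \<Longrightarrow> f x \<in> {0..1}"
    and deriv1: "x \<ge> 0 \<Longrightarrow> (f has_real_derivative f' x) (at x within {0..})"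
    and deriv2: "x \<ge> 0 \<Longrightarrow> (f' has_real_derivative f'' x) (at x within {0..})"
    and deriv3: "x \<ge> 0 \<Longrightarrow> (f'' has_real_derivative f''' x) (at x within {0..})"
    and f_convex: "convex_on {0..} f"
    and log_concave: "x \<ge> 0 \<Longrightarrow> f''' x * f' x \<le> (f'' x)\<^sup>2"
    and f_lim: "(f \<longlongrightarrow> 0) at_top"
    and f_0: "f 0 = 1"
begin

section \<open>Sign and monotonicity of \<open>f'\<close>\<close>

lemma deriv_at:
  assumes "0 < x"
  shows "(f has_real_derivative f' x) (at x)" "(f' has_real_derivative f'' x) (at x)"
    "(f'' has_real_derivative f''' x) (at x)"
proof -
  have *: "at x within {0..} = at x"
    using assms by (intro at_within_interior) simp
  have "0 \<le> x" using assms by simp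
  from deriv1[OF this] deriv2[OF this] deriv3[OF this]
  show "(f has_real_derivative f' x) (at x)" "(f' has_real_derivative f'' x) (at x)"
    "(f'' has_real_derivative f''' x) (at x)"
    unfolding * .
qed

lemma cont: "continuous_on {0..} f" "continuous_on {0..} f'" "continuous_on {0..} f''"
  by (rule DERIV_continuous_on, rule deriv1 deriv2 deriv3, simp)+

lemma cont_compose [continuous_intros]:
  assumes "continuous_on A g" "\<And>x. x \<in> A \<Longrightarrow> 0 \<le> g x"
  shows "continuous_on A (\<lambda>x. f (g x))" "continuous_on A (\<lambda>x. f' (g x))" "continuous_on A (\<lambda>x. f'' (g x))"
  by (rule continuous_on_compose2[OF _ assms(1)], rule cont, use assms(2) in auto)+

lemma deriv_chain [derivative_intros]:
  assumes "0 < c + x"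
  shows "((\<lambda>x. f (c + x)) has_real_derivative f' (c + x)) (at x)"
    "((\<lambda>x. f' (c + x)) has_real_derivative f'' (c + x)) (at x)"
  using deriv_at(1,2)[OF assms] DERIV_shift[of _ _ x c] by (auto simp: add.commute)

lemma tangent: "0 < x \<Longrightarrow> 0 \<le> y \<Longrightarrow> f' x * (y - x) \<le> f y - f x"
  by (rule convex_on_imp_above_tangent[OF f_convex _ _ _ deriv1]) auto

lemma f'_mono:
  assumes "0 \<le> x" "x \<le> y"
  shows "f' x \<le> f' y"
proof -
  have *: "f' x \<le> f' y" if "0 < x" "x < y" for x y
  proof -
    have "0 \<le> (f' y - f' x) * (y - x)"
      using tangent[of x y] tangent[of y x] that by (simp add: algebra_simps)
    then show ?thesis using that by (simp add: zero_le_mult_iff)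
  qed
  show ?thesis
  proof (cases "x = 0 \<and> x < y")
    case True
    \<comment> \<open>Tangent lines are available at interior points only; the end point
      \<open>0\<close> follows by a limit from the right.\<close>
    have "(f' \<longlongrightarrow> f' 0) (at_right 0)"
      using cont(2) by (auto simp: continuous_on_def intro: tendsto_within_subset)
    moreover have "eventually (\<lambda>x. f' x \<le> f' y) (at_right 0)"
      using True eventually_at_right_less[of 0] eventually_at_right[of 0 y "\<lambda>x. f' x \<le> f' y"] * by auto
    ultimately show ?thesis
      using True tendsto_upperbound[of f' "f' 0" "at_right 0" "f' y"] by auto
  next
    case False
    then show ?thesis using *[of x y] assms by (cases "x = y") auto
  qed
qed

lemma f'_nonpos:
  assumes "0 \<le> x"
  shows "f' x \<le> 0"
proof (rule ccontr)
  assume neg: "\<not> f' x \<le> 0"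
  \<comment> \<open>At an interior point with positive slope the tangent would rise by
    \<open>2\<close> within distance \<open>2 / f' y\<close>, which the range \<open>[0, 1]\<close>
    of \<open>f\<close> forbids.\<close>
  define y where "y = x + 1"
  have y: "0 < y" "0 < f' y" using f'_mono[of x y] assms neg by (auto simp: y_def)
  have "f' y * ((y + 2 / f' y) - y) \<le> f (y + 2 / f' y) - f y"
    using y by (intro tangent) auto
  then have "2 \<le> f (y + 2 / f' y) - f y" using y by simp
  moreover have "f (y + 2 / f' y) \<le> 1" "0 \<le> f y" using f_range y by auto
  ultimately show False by linarith
qed

lemma f_antimono:
  assumes "0 \<le> x" "x \<le> y"
  shows "f y \<le> f x"
proof (rule DERIV_nonpos_imp_decreasing_open[OF assms(2)])
  fix t assume "x < t" "t < y"
  then show "\<exists>d. (f has_real_derivative d) (at t) \<and> d \<le> 0"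
    using deriv_at(1)[of t] f'_nonpos[of t] assms by auto
next
  show "continuous_on {x..y} f"
    by (rule continuous_on_subset[OF cont(1)]) (use assms in auto)
qed

text \<open>Otherwise \<open>f'\<close> would vanish identically by monotonicity, and
  \<open>f\<close> could not fall from \<open>1\<close> to its limit \<open>0\<close>.\<close>

lemma f'_0_neg: "f' 0 < 0"
proof (rule ccontr)
  assume "\<not> f' 0 < 0"
  then have z: "f' x = 0" if "0 \<le> x" for x
    using f'_mono[of 0 x] f'_nonpos[of x] that by simp
  have "1 \<le> f x" if "0 \<le> x" for x
    unfolding f_0[symmetric]
  proof (rule DERIV_nonneg_imp_increasing_open[OF that])
    fix t assume "0 < t" "t < x"
    then show "\<exists>d. (f has_real_derivative d) (at t) \<and> d \<ge> 0"
      using deriv_at(1)[of t] z[of t] by auto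
  next
    show "continuous_on {0..x} f"
      by (rule continuous_on_subset[OF cont(1)]) auto
  qed
  then have "eventually (\<lambda>x. 1 \<le> f x) at_top"
    by (rule eventually_at_top_linorderI)
  then show False
    using tendsto_lowerbound[OF f_lim] by fastforce
qed

text \<open>Log-concavity makes \<open>f'' / f'\<close> decreasing while \<open>f'\<close> is
  nonzero, and then \<open>f' (x + s + u) / f' (x + u)\<close> decreases in \<open>u\<close>. If
  \<open>f' (x + s + u) = 0\<close>, the left-hand side is \<open>0\<close>; otherwise monotonicity
  keeps \<open>f'\<close> negative on all of \<open>[0, x + s + u]\<close>.\<close>

lemma log_concave_ratio:
  assumes "0 \<le> x" "0 \<le> s" "0 \<le> u"
  shows "f' x * f' (x + s + u) \<le> f' (x + s) * f' (x + u)"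
proof (cases "f' (x + s + u) = 0")
  case True
  then show ?thesis using f'_nonpos[of "x + s"] f'_nonpos[of "x + u"] assms by (simp add: mult_nonpos_nonpos)
next
  case False
  define b where "b = x + s + u"
  have neg: "f' t < 0" if "0 \<le> t" "t \<le> b" for t
    using f'_mono[of t b] f'_nonpos[of b] False that assms by (auto simp: b_def)
  have ratio: "f'' z / f' z \<le> f'' y / f' y" if "0 \<le> y" "y \<le> z" "z \<le> b" for y z
  proof (rule DERIV_nonpos_imp_decreasing_open[OF that(2)])
    fix t assume t: "y < t" "t < z"
    then have t': "0 < t" "f' t \<noteq> 0" "f''' t * f' t \<le> (f'' t)\<^sup>2"
      using that neg[of t] log_concave[of t] by auto
    then have "((\<lambda>t. f'' t / f' t) has_real_derivative (f''' t * f' t - f'' t * f'' t) / (f' t * f' t)) (at t)"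
      by (intro DERIV_divide deriv_at)
    moreover have "(f''' t * f' t - f'' t * f'' t) / (f' t * f' t) \<le> 0"
      using t' by (intro divide_nonpos_nonneg) (auto simp: power2_eq_square)
    ultimately show "\<exists>d. ((\<lambda>t. f'' t / f' t) has_real_derivative d) (at t) \<and> d \<le> 0" by blast
  next
    show "continuous_on {y..z} (\<lambda>t. f'' t / f' t)"
      using that neg by (intro continuous_intros) (auto simp: less_imp_neq)
  qed
  have "f' (x + s + u) / f' (x + u) \<le> f' (x + s + 0) / f' (x + 0)"
  proof (rule DERIV_nonpos_imp_decreasing_open[OF assms(3)])
    fix t assume t: "0 < t" "t < u"
    let ?A = "x + s + t" and ?B = "x + t"
    have n: "f' ?A < 0" "f' ?B < 0" and pos: "0 < ?A" "0 < ?B"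
      using t assms by (auto intro!: neg simp: b_def)
    have "f'' ?A / f' ?A \<le> f'' ?B / f' ?B"
      by (rule ratio) (use t assms in \<open>auto simp: b_def\<close>)
    then have "f'' ?A * f' ?B - f' ?A * f'' ?B \<le> 0"
      using n by (simp add: divide_simps mult.commute split: if_splits)
    then have "(f'' ?A * f' ?B - f' ?A * f'' ?B) / (f' ?B * f' ?B) \<le> 0"
      by (intro divide_nonpos_nonneg) auto
    moreover have "((\<lambda>t. f' (x + s + t) / f' (x + t)) has_real_derivative
        (f'' ?A * f' ?B - f' ?A * f'' ?B) / (f' ?B * f' ?B)) (at t)"
      using n pos by (intro DERIV_divide deriv_chain) auto
    ultimately show "\<exists>d. ((\<lambda>t. f' (x + s + t) / f' (x + t)) has_real_derivative d) (at t) \<and> d \<le> 0" by blast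
  next
    show "continuous_on {0..u} (\<lambda>t. f' (x + s + t) / f' (x + t))"
      using assms neg by (intro continuous_intros) (auto simp: b_def less_imp_neq)
  qed
  moreover have "f' (x + u) < 0" "f' x < 0" using neg assms by (auto simp: b_def)
  ultimately show ?thesis
    by (simp add: divide_simps mult.commute split: if_splits)
qed

text \<open>The tail of a log-concave density is log-concave: this is
  \<open>log_concave_ratio\<close> integrated over \<open>u\<close> up to infinity. The auxiliary
  \<open>m\<close> decreases to the limit \<open>0\<close>, hence \<open>m 0\<close> is
  nonnegative.\<close>

lemma log_concave_tail:
  assumes "0 \<le> x" "0 \<le> s"
  shows "f' (x + s) * f x \<le> f (x + s) * f' x"
proof -
  define m where "m u = f' x * f (x + s + u) - f' (x + s) * f (x + u)" for u
  have "m y \<le> m 0" if "0 \<le> y" for y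
  proof (rule DERIV_nonpos_imp_decreasing_open[OF that])
    fix t assume t: "0 < t" "t < y"
    then have "(m has_real_derivative f' x * f' (x + s + t) - f' (x + s) * f' (x + t)) (at t)"
      unfolding m_def using assms by (intro derivative_intros DERIV_cmult deriv_chain) auto
    then show "\<exists>d. (m has_real_derivative d) (at t) \<and> d \<le> 0"
      using log_concave_ratio[of x s t] assms t by (intro exI conjI) auto
  next
    show "continuous_on {0..y} m"
      unfolding m_def using assms by (intro continuous_intros) auto
  qed
  then have "eventually (\<lambda>y. m y \<le> m 0) at_top"
    by (rule eventually_at_top_linorderI)
  moreover have "((\<lambda>u. f (c + u)) \<longlongrightarrow> 0) at_top" for c
    by (rule filterlim_compose[OF f_lim]) real_asymp
  then have "(m \<longlongrightarrow> f' x * 0 - f' (x + s) * 0) at_top"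
    unfolding m_def by (intro tendsto_intros)
  ultimately have "0 \<le> m 0"
    using tendsto_upperbound[of m 0 at_top "m 0"] by simp
  then show ?thesis by (simp add: m_def mult.commute)
qed

text \<open>By \<open>log_concave_tail\<close> the quotient \<open>f (y + t) / f t\<close> decreases
  in \<open>t\<close>, and at \<open>t = 0\<close> it is \<open>f y\<close>.\<close>

lemma f_submult:
  assumes "0 \<le> x" "0 \<le> y"
  shows "f (x + y) \<le> f x * f y"
proof (cases "f x = 0")
  case True
  then show ?thesis using f_antimono[of x "x + y"] assms by simp
next
  case False
  have pos: "0 < f t" if "0 \<le> t" "t \<le> x" for t
    using f_antimono[OF that] False f_range[of x] assms by auto
  have "f (y + x) / f (0 + x) \<le> f (y + 0) / f (0 + 0)"
  proof (rule DERIV_nonpos_imp_decreasing_open[OF assms(1)])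
    fix t assume t: "0 < t" "t < x"
    then have "((\<lambda>t. f (y + t) / f (0 + t)) has_real_derivative
        (f' (y + t) * f (0 + t) - f (y + t) * f' (0 + t)) / (f (0 + t) * f (0 + t))) (at t)"
      (is "(_ has_real_derivative ?D) _")
      using pos[of t] assms by (intro DERIV_divide deriv_chain) auto
    moreover have "?D \<le> 0"
      using log_concave_tail[of t y] t assms by (intro divide_nonpos_nonneg) (auto simp: add.commute)
    ultimately show "\<exists>d. ((\<lambda>t. f (y + t) / f (0 + t)) has_real_derivative d) (at t) \<and> d \<le> 0" by blast
  next
    show "continuous_on {0..x} (\<lambda>t. f (y + t) / f (0 + t))"
      using assms pos by (intro continuous_intros) (auto simp: less_imp_neq[symmetric])
  qed
  then show ?thesis
    using pos[of x] assms f_0 by (simp add: field_simps)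
qed

lemma f_lipschitz:
  assumes "0 \<le> x" "0 \<le> y"
  shows "f x - f (x + y) \<le> - f' 0 * y"
proof -
  have "f (x + 0) - f' 0 * 0 \<le> f (x + y) - f' 0 * y"
  proof (rule DERIV_nonneg_imp_increasing_open[OF assms(2)])
    fix t assume t: "0 < t" "t < y"
    have "((\<lambda>t. f (x + t) - f' 0 * t) has_real_derivative f' (x + t) - f' 0 * 1) (at t)"
      (is "(_ has_real_derivative ?D) _")
      using t assms by (intro derivative_intros DERIV_cmult deriv_chain) auto
    moreover have "?D \<ge> 0"
      using f'_mono[of 0 "x + t"] t assms by simp
    ultimately show "\<exists>d. ((\<lambda>t. f (x + t) - f' 0 * t) has_real_derivative d) (at t) \<and> d \<ge> 0" by blast
  qed (use assms in \<open>auto intro!: continuous_intros\<close>)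
  then show ?thesis by simp
qed

text \<open>\<open>log_concave_ratio\<close> with base point \<open>0\<close> gives
  \<open>f' 0 * f' (x + t) \<le> f' x * f' t\<close>; integrate over \<open>t\<close> from
  \<open>0\<close> to \<open>s\<close>.\<close>

lemma decrement_le:
  assumes "0 \<le> x" "0 \<le> s"
  shows "- f' 0 * (f x - f (x + s)) \<le> - f' x * (1 - f s)"
proof -
  have "f' 0 * f (x + 0) * (- 1) + f' x * f (0 + 0) \<le> f' 0 * f (x + s) * (- 1) + f' x * f (0 + s)"
  proof (rule DERIV_nonneg_imp_increasing_open[OF assms(2)])
    fix t assume t: "0 < t" "t < s"
    have "((\<lambda>t. f' 0 * f (x + t) * (- 1) + f' x * f (0 + t)) has_real_derivative
        f' 0 * f' (x + t) * (- 1) + f' x * f' (0 + t)) (at t)"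
      (is "(_ has_real_derivative ?D) _")
      using t assms by (intro derivative_intros DERIV_cmult DERIV_cmult_right deriv_chain) auto
    moreover have "?D \<ge> 0"
      using log_concave_ratio[of 0 x t] t assms by simp
    ultimately show "\<exists>d. ((\<lambda>t. f' 0 * f (x + t) * (- 1) + f' x * f (0 + t)) has_real_derivative d) (at t) \<and> d \<ge> 0"
      by blast
  qed (use assms in \<open>auto intro!: continuous_intros\<close>)
  then show ?thesis by (simp add: f_0 algebra_simps)
qed

section \<open>The drop of the advanced rate\<close>

lemma f_bound: "0 \<le> x \<Longrightarrow> \<bar>f x\<bar> \<le> 1"
  using f_range[of x] by auto

lemma advance_bound: "0 \<le> x \<Longrightarrow> 0 \<le> y \<Longrightarrow> \<bar>advance x f y\<bar> \<le> 1"
  using f_bound[of "x + y"] by (simp add: advance_def)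

lemma advance_decrement:
  assumes "0 \<le> x"
  shows "exp_drop (advance x f) = exp_mean (\<lambda>t. f x - f (x + t))"
    and "(\<lambda>t. exp (- t) * (f x - f (x + t))) integrable_on {0..}"
proof -
  note adv = continuous_on_advance[OF cont(1) assms] advance_bound[OF assms]
  show "exp_drop (advance x f) = exp_mean (\<lambda>t. f x - f (x + t))"
    using exp_drop_eq_mean[OF adv] unfolding advance_def by simp
  show "(\<lambda>t. exp (- t) * (f x - f (x + t))) integrable_on {0..}"
    using exp_diff_integrable[OF adv] unfolding advance_def by simp
qed

text \<open>The decrement is at most \<open>- f' 0 * t\<close>, whose exponential mean is
  \<open>- f' 0\<close>. This makes the numerator of the bound on \<open>r\<close>
  nonnegative.\<close>

lemma exp_drop_le_slope: "exp_drop f \<le> - f' 0"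
proof -
  have "exp_drop f = exp_mean (\<lambda>t. f 0 - f (0 + t))"
    using advance_decrement(1)[of 0] by simp
  also have "\<dots> \<le> exp_mean (\<lambda>t. - f' 0 * t)"
    by (rule exp_mean_mono[OF advance_decrement(2)[OF order_refl] integrable_exp_ident])
      (rule f_lipschitz[OF order_refl])
  also have "\<dots> = - f' 0" by (rule exp_mean_ident_mult)
  finally show ?thesis .
qed

lemma exp_drop_advance_ratio:
  assumes "0 \<le> x"
  shows "- f' 0 * exp_drop (advance x f) \<le> - f' x * exp_drop f"
proof -
  have "- f' 0 * exp_drop (advance x f) = exp_mean (\<lambda>t. - f' 0 * (f x - f (x + t)))"
    unfolding advance_decrement(1)[OF assms] by (rule exp_mean_cmult[symmetric])
  also have "\<dots> \<le> exp_mean (\<lambda>t. - f' x * (f 0 - f (0 + t)))"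
  proof (rule exp_mean_mono)
    show "(\<lambda>t. exp (- t) * (- f' 0 * (f x - f (x + t)))) integrable_on {0..}"
      "(\<lambda>t. exp (- t) * (- f' x * (f 0 - f (0 + t)))) integrable_on {0..}"
      using integrable_on_mult_right[OF advance_decrement(2)[OF assms], of "- f' 0"]
        integrable_on_mult_right[OF advance_decrement(2)[OF order_refl], of "- f' x"]
      by (simp_all only: mult.left_commute)
    show "- f' 0 * (f x - f (x + t)) \<le> - f' x * (f 0 - f (0 + t))" if "0 \<le> t" for t
      using decrement_le[OF assms that] by (simp only: f_0 add_0)
  qed
  also have "\<dots> = - f' x * exp_mean (\<lambda>t. f 0 - f (0 + t))"
    by (rule exp_mean_cmult)
  also have "exp_mean (\<lambda>t. f 0 - f (0 + t)) = exp_drop f"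
    using advance_decrement(1)[of 0] by simp
  finally show ?thesis .
qed

lemma ocs_rate:
  assumes r: "0 \<le> r" and r_le: "r \<le> (- f' 0 - exp_drop f) / (exp_drop f + (1 - exp_drop f) * f' 0)"
  shows "ocs_rate f r (- f' 0)"
proof
  define D where "D = exp_drop f + (1 - exp_drop f) * f' 0"
  have num: "0 \<le> - f' 0 - exp_drop f" using exp_drop_le_slope by simp
  text \<open>If the denominator is not positive, then the quotient is at most \<open>0\<close> (division by \<open>0\<close> gives \<open>0\<close>).\<close>
  have cond: "r * D \<le> - f' 0 - exp_drop f"
  proof (cases "0 < D")
    case True
    then show ?thesis using r_le by (simp add: D_def[symmetric] pos_le_divide_eq)
  next
    case False
    then have "(- f' 0 - exp_drop f) / D \<le> 0"
      using num by (simp add: divide_nonneg_nonpos)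
    then have "r \<le> 0" using r_le by (simp add: D_def[symmetric])
    then show ?thesis using r num by simp
  qed
  let ?s = "\<lambda>x. r * exp_drop f * f x - (1 + r) * exp_drop (advance x f)"
  show "?s x \<le> ?s y" if xy: "0 \<le> x" "x \<le> y" for x y
  proof (rule DERIV_nonneg_imp_increasing_open[OF xy(2)])
    fix t assume "x < t" "t < y"
    then have t: "0 < t" using xy by simp
    let ?D = "r * exp_drop f * f' t - (1 + r) * (f' t - (- exp_drop (advance t f)))"
    have "((\<lambda>x. r * exp_drop f * f x - (1 + r) * (f x - exp_mean (advance x f))) has_real_derivative ?D) (at t)"
      by (intro DERIV_diff DERIV_cmult deriv_at t exp_mean_advance_has_derivative cont f_bound)
    then have "(?s has_real_derivative ?D) (at t)"
      by (simp add: exp_drop_def[of "advance _ f"])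
    moreover have "0 \<le> ?D"
    proof -
      \<comment> \<open>The positive factor \<open>- f' 0\<close> clears the ratio of slopes in
        \<open>exp_drop_advance_ratio\<close>; what remains is \<open>cond\<close> in the form
        \<open>(1 + r) * exp_drop f \<le> - f' 0 * (1 + r - r * exp_drop f)\<close>.\<close>
      have "- f' 0 * ((1 + r) * exp_drop (advance t f)) \<le> (1 + r) * (- f' t * exp_drop f)"
        using mult_left_mono[OF exp_drop_advance_ratio[of t], of "1 + r"] t r by (simp add: mult.left_commute)
      also have "\<dots> = - f' t * ((1 + r) * exp_drop f)" by simp
      also have "\<dots> \<le> - f' t * (- f' 0 * (1 + r - r * exp_drop f))"
        using cond f'_nonpos[of t] t by (intro mult_left_mono) (auto simp: D_def algebra_simps)
      finally have "0 \<le> - f' 0 * ?D" by (simp add: algebra_simps)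
      then show ?thesis using f'_0_neg by (subst (asm) zero_le_mult_iff) linarith
    qed
    ultimately show "\<exists>d. (?s has_real_derivative d) (at t) \<and> d \<ge> 0" by blast
  next
    have "continuous_on {x..y} (\<lambda>x. exp_mean (advance x f))"
      by (rule continuous_on_subset[OF continuous_on_exp_mean_advance[OF cont(1) f_bound, of y]]) (use xy in auto)
    then show "continuous_on {x..y} ?s"
      unfolding exp_drop_def[of "advance _ f"] advance_at_0
      by (intro continuous_intros continuous_on_subset[OF cont(1)]) (use xy in auto)
  qed
qed (use f_0 f_range cont f_convex f_submult f_lipschitz r f'_0_neg in auto)

end

section \<open>Primal-dual allocation\<close>

lemma prob_vectors_ge_0: "p \<in> prob_vectors L \<Longrightarrow> 0 \<le> p i"
  unfolding prob_vectors_def by (cases "i \<in> L") auto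

lemma prob_vectors_le_1:
  assumes "p \<in> prob_vectors L" "finite L"
  shows "p i \<le> 1"
proof (cases "i \<in> L")
  case True
  then have "p i \<le> (\<Sum>i\<in>L. p i)"
    using assms prob_vectors_ge_0[OF assms(1)] by (intro member_le_sum) auto
  then show ?thesis using assms by (simp add: prob_vectors_def)
qed (use assms in \<open>simp add: prob_vectors_def\<close>)

lemma point_mass_prob_vectors:
  assumes "finite L" "k \<in> L"
  shows "(\<lambda>i. if i = k then 1 else 0) \<in> prob_vectors L"
  using assms by (auto simp: prob_vectors_def)

lemma prob_vectors_convex:
  assumes "p \<in> prob_vectors L" "p' \<in> prob_vectors L" "0 \<le> e" "e \<le> 1"
  shows "(\<lambda>i. p i + e * (p' i - p i)) \<in> prob_vectors L"
proof -
  have "p i + e * (p' i - p i) = (1 - e) * p i + e * p' i" for i by (simp add: algebra_simps)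
  then show ?thesis
    using assms by (auto simp: prob_vectors_def sum.distrib sum_distrib_left[symmetric])
qed

text \<open>The simplex is a closed hyperplane section of a product of compact sets, with factor
  \<open>{0}\<close> outside \<open>L\<close>; Tychonoff applies.\<close>

lemma compact_prob_vectors:
  assumes "finite L"
  shows "compact (prob_vectors L)"
proof -
  let ?B = "Pi\<^sub>E UNIV (\<lambda>i. if i \<in> L then {0..1} else {0 :: real})"
  have "compactin (product_topology (\<lambda>_. euclidean) UNIV) ?B"
    by (subst compactin_PiE) auto
  then have B: "compact ?B"
    by (simp add: euclidean_product_topology)
  have "prob_vectors L = ?B \<inter> {p. (\<Sum>i\<in>L. p i) = 1}"
  proof (intro set_eqI iffI)
    fix p assume "p \<in> prob_vectors L"
    then show "p \<in> ?B \<inter> {p. (\<Sum>i\<in>L. p i) = 1}"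
      using prob_vectors_ge_0[of p L] prob_vectors_le_1[of p L] assms by (auto simp: prob_vectors_def)
  next
    fix p assume p: "p \<in> ?B \<inter> {p. (\<Sum>i\<in>L. p i) = 1}"
    then have *: "p i \<in> (if i \<in> L then {0..1} else {0})" for i by (auto simp: PiE_iff)
    have "0 \<le> p i" if "i \<in> L" for i using *[of i] that by simp
    moreover have "p i = 0" if "i \<notin> L" for i using *[of i] that by simp
    ultimately show "p \<in> prob_vectors L"
      using p by (simp add: prob_vectors_def)
  qed
  moreover have "closed {p :: 'a \<Rightarrow> real. (\<Sum>i\<in>L. p i) = 1}"
    by (intro closed_Collect_eq continuous_intros continuous_on_product_coordinates)
  ultimately show ?thesis
    using B by (simp add: compact_Int_closed)
qed

section \<open>Level profiles of an offline vertex\<close>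

context ocs_rate
begin

definition update :: "real \<Rightarrow> real \<Rightarrow> (real \<Rightarrow> real \<Rightarrow> real) \<Rightarrow> real \<Rightarrow> real \<Rightarrow> real" where
  "update q v H = (\<lambda>u. if u \<le> v then advance q (H u) else gap q (H u))"

text \<open>\<open>H u\<close> is the state of an offline vertex with respect to the steps whose weight is at least \<open>u\<close>.\<close>
inductive profile :: "(real \<Rightarrow> real \<Rightarrow> real) \<Rightarrow> bool" where
  init: "profile (\<lambda>_. f)"
| update: "profile H \<Longrightarrow> 0 \<le> q \<Longrightarrow> profile (update q v H)"

lemma profile_good: "profile H \<Longrightarrow> good (H u)"
  by (induction rule: profile.induct) (auto simp: update_def good_f good_advance good_gap)

text \<open>A profile is a step function of the level, so any functional of its value is measurable.
  Generalising over \<open>\<Phi>\<close> lets the induction absorb \<open>advance q\<close> and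
  \<open>gap q\<close>.\<close>

lemma profile_measurable: "profile H \<Longrightarrow> (\<lambda>u. \<Phi> (H u) :: real) \<in> borel_measurable borel"
proof (induction arbitrary: \<Phi> rule: profile.induct)
  case (update H q v)
  have "(\<lambda>u. \<Phi> (update q v H u)) = (\<lambda>u. if u \<le> v then (\<Phi> \<circ> advance q) (H u) else (\<Phi> \<circ> gap q) (H u))"
    by (auto simp: update_def)
  also have "\<dots> \<in> borel_measurable borel"
    using update.IH[of "\<Phi> \<circ> advance q"] update.IH[of "\<Phi> \<circ> gap q"] by measurable
  finally show ?case .
qed simp

lemma profile_finite_range: "profile H \<Longrightarrow> finite (range H)"
proof (induction rule: profile.induct)
  case (update H q v)
  have "range (update q v H) \<subseteq> advance q ` range H \<union> gap q ` range H"
    by (auto simp: update_def)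
  then show ?case using update.IH by (auto intro: finite_subset)
qed auto

lemma profile_eventually_f: "profile H \<Longrightarrow> \<exists>b. \<forall>u>b. H u = f"
proof (induction rule: profile.induct)
  case (update H q v)
  then obtain b where "\<forall>u>b. H u = f" by blast
  then have "\<forall>u>max b v. update q v H u = f" by (auto simp: update_def)
  then show ?case by blast
qed auto

text \<open>A profile has finitely many values, and at high levels it is \<open>f\<close>, where
  \<open>\<Psi>\<close> vanishes: the integrand is bounded with bounded support.\<close>

lemma profile_integrable:
  assumes H: "profile H" and \<Psi>: "\<Psi> f = 0"
  shows "set_integrable lborel {0<..} (\<lambda>u. if u \<le> v then \<Phi> (H u) else \<Psi> (H u) :: real)"
proof -
  obtain b where b: "\<And>u. u > b \<Longrightarrow> H u = f" using profile_eventually_f[OF H] by blast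
  obtain C where C: "\<And>u. \<bar>\<Phi> (H u)\<bar> \<le> C" "\<And>u. \<bar>\<Psi> (H u)\<bar> \<le> C"
  proof -
    have fin: "finite ((\<lambda>h. \<bar>\<Phi> h\<bar>) ` range H \<union> (\<lambda>h. \<bar>\<Psi> h\<bar>) ` range H)"
      using profile_finite_range[OF H] by blast
    show ?thesis
      by (rule that[of "Max ((\<lambda>h. \<bar>\<Phi> h\<bar>) ` range H \<union> (\<lambda>h. \<bar>\<Psi> h\<bar>) ` range H)"]) (rule Max_ge[OF fin], blast)+
  qed
  let ?g = "\<lambda>u. if u \<le> v then \<Phi> (H u) else \<Psi> (H u)"
  have meas: "?g \<in> borel_measurable borel"
    using profile_measurable[OF H, of \<Phi>] profile_measurable[OF H, of \<Psi>] by measurable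
  have "integrable lborel (\<lambda>u. C * indicator {0<..max b v} u :: real)"
    by (intro integrable_mult_right integrable_real_indicator emeasure_bounded_finite) auto
  then show ?thesis
    unfolding set_integrable_def
  proof (rule Bochner_Integration.integrable_bound)
    show "(\<lambda>u. indicator {0<..} u *\<^sub>R ?g u) \<in> borel_measurable lborel"
      using meas by measurable
    have "norm (indicator {0<..} u *\<^sub>R ?g u) \<le> norm (C * indicator {0<..max b v} u)" for u
      using C[of u] b[of u] \<Psi> by (auto simp: indicator_def)
    then show "AE u in lborel. norm (indicator {0<..} u *\<^sub>R ?g u) \<le> norm (C * indicator {0<..max b v} u :: real)"
      by simp
  qed
qed

lemma profile_integrable':
  assumes "profile H" and "\<Psi> f = 0"
  shows "set_integrable lborel {0<..} (\<lambda>u. \<Psi> (H u) :: real)"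
  using profile_integrable[of H \<Psi> 0 \<Psi>] assms by simp

definition gap_cost :: "(real \<Rightarrow> real) \<Rightarrow> real" where
  "gap_cost h = r * (exp_drop h - h 0 * exp_drop f)"

text \<open>Primal minus dual increase of a vertex that is offered mass \<open>q\<close> at weight
  \<open>v\<close>, except that the dual increase at gap levels is replaced by an upper bound linear
  in \<open>q\<close>. This makes it concave in \<open>q\<close>, with \<open>price\<close> as
  supergradient.\<close>

definition gain :: "(real \<Rightarrow> real \<Rightarrow> real) \<Rightarrow> real \<Rightarrow> real \<Rightarrow> real" where
  "gain H v q = (LINT u:{0<..}|lborel.
     if u \<le> v then exp_mean (H u) - exp_mean (advance q (H u)) else - q * gap_cost (H u))"

definition price :: "(real \<Rightarrow> real \<Rightarrow> real) \<Rightarrow> real \<Rightarrow> real \<Rightarrow> real" where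
  "price H v q = (LINT u:{0<..}|lborel. if u \<le> v then exp_drop (advance q (H u)) else - gap_cost (H u))"

text \<open>Layer-cake form of a lower bound on the expected value of a vertex:
  \<open>1 - H u 0\<close> is at most the probability of a win of weight at least
  \<open>u\<close>.\<close>

definition won :: "(real \<Rightarrow> real \<Rightarrow> real) \<Rightarrow> real" where
  "won H = (LINT u:{0<..}|lborel. 1 - H u 0)"

definition dual :: "(real \<Rightarrow> real \<Rightarrow> real) \<Rightarrow> real" where
  "dual H = (LINT u:{0<..}|lborel. exp_drop f - exp_drop (H u))"

lemma gap_cost_f [simp]: "gap_cost f = 0"
  by (simp add: gap_cost_def f_0)

lemma integrable_gain:
  "profile H \<Longrightarrow> set_integrable lborel {0<..}
     (\<lambda>u. if u \<le> v then exp_mean (H u) - exp_mean (advance q (H u)) else - q * gap_cost (H u))"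
  using profile_integrable[of H "\<lambda>h. - q * gap_cost h" v "\<lambda>h. exp_mean h - exp_mean (advance q h)"] by simp

lemma integrable_price:
  "profile H \<Longrightarrow> set_integrable lborel {0<..} (\<lambda>u. if u \<le> v then exp_drop (advance q (H u)) else - gap_cost (H u))"
  using profile_integrable[of H "\<lambda>h. - gap_cost h" v "\<lambda>h. exp_drop (advance q h)"] by simp

lemma integrable_won: "profile H \<Longrightarrow> set_integrable lborel {0<..} (\<lambda>u. 1 - H u 0)"
  using profile_integrable'[of H "\<lambda>h. 1 - h 0"] by (simp add: f_0)

lemma integrable_dual: "profile H \<Longrightarrow> set_integrable lborel {0<..} (\<lambda>u. exp_drop f - exp_drop (H u))"
  using profile_integrable'[of H "\<lambda>h. exp_drop f - exp_drop h"] by simp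

lemma gain_0 [simp]: "gain H v 0 = 0"
  by (simp add: gain_def set_lebesgue_integral_def cong: if_cong)

lemma won_init [simp]: "won (\<lambda>_. f) = 0" and dual_init [simp]: "dual (\<lambda>_. f) = 0"
  by (simp_all add: won_def dual_def f_0 set_lebesgue_integral_def)

lemma gain_bounds:
  assumes H: "profile H" and q: "0 \<le> q" "q \<le> q'"
  shows "(q' - q) * price H v q' \<le> gain H v q' - gain H v q"
    and "gain H v q' - gain H v q \<le> (q' - q) * price H v q"
proof -
  let ?g = "\<lambda>q u. if u \<le> v then exp_mean (H u) - exp_mean (advance q (H u)) else - q * gap_cost (H u)"
  let ?p = "\<lambda>q u. if u \<le> v then exp_drop (advance q (H u)) else - gap_cost (H u)"
  have diff: "gain H v q' - gain H v q = (LINT u:{0<..}|lborel. ?g q' u - ?g q u)"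
    unfolding gain_def by (rule set_integral_diff(2)[symmetric]; rule integrable_gain[OF H])
  have int_diff: "set_integrable lborel {0<..} (\<lambda>u. ?g q' u - ?g q u)"
    by (rule set_integral_diff(1); rule integrable_gain[OF H])
  have int_mult: "set_integrable lborel {0<..} (\<lambda>u. (q' - q) * ?p x u)" for x
    using integrable_price[OF H] by (rule set_integrable_mult_right)
  have mult: "(q' - q) * price H v x = (LINT u:{0<..}|lborel. (q' - q) * ?p x u)" for x
    unfolding price_def by simp
  have "(q' - q) * ?p q' u \<le> ?g q' u - ?g q u" "?g q' u - ?g q u \<le> (q' - q) * ?p q u" for u
    using exp_mean_advance_bounds[OF profile_good[OF H, of u] q] by (auto simp: algebra_simps)
  note bounds = this
  show "(q' - q) * price H v q' \<le> gain H v q' - gain H v q"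
    unfolding mult diff by (rule set_integral_mono[OF int_mult int_diff]) (rule bounds)
  show "gain H v q' - gain H v q \<le> (q' - q) * price H v q"
    unfolding mult diff by (rule set_integral_mono[OF int_diff int_mult]) (rule bounds)
qed

lemma price_bounds:
  assumes H: "profile H" and q: "0 \<le> q" "q \<le> q'"
  shows "price H v q' \<le> price H v q" and "price H v q - price H v q' \<le> K * max 0 v * (q' - q)"
proof -
  let ?p = "\<lambda>q u. if u \<le> v then exp_drop (advance q (H u)) else - gap_cost (H u)"
  have "?p q' u \<le> ?p q u" for u
    using exp_drop_advance_antimono[OF profile_good[OF H, of u] q] by simp
  then show "price H v q' \<le> price H v q"
    unfolding price_def by (intro set_integral_mono integrable_price[OF H])
  have "price H v q - price H v q' = (LINT u:{0<..}|lborel. ?p q u - ?p q' u)"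
    unfolding price_def by (rule set_integral_diff(2)[symmetric]; rule integrable_price[OF H])
  also have "\<dots> \<le> (LINT u:{0<..}|lborel. if u \<le> v then K * (q' - q) else 0)"
  proof (rule set_integral_mono)
    show "set_integrable lborel {0<..} (\<lambda>u. ?p q u - ?p q' u)"
      by (rule set_integral_diff(1); rule integrable_price[OF H])
    show "set_integrable lborel {0<..} (\<lambda>u. if u \<le> v then K * (q' - q) else 0)"
      using profile_integrable[OF H, of "\<lambda>_. 0" v "\<lambda>_. K * (q' - q)"] by simp
    show "?p q u - ?p q' u \<le> (if u \<le> v then K * (q' - q) else 0)" for u
      using exp_drop_advance_lipschitz[OF profile_good[OF H, of u] q] by simp
  qed
  also have "\<dots> = (LINT u|lborel. K * (q' - q) * indicator {0<..max 0 v} u)"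
    unfolding set_lebesgue_integral_def by (intro Bochner_Integration.integral_cong) (auto simp: indicator_def)
  also have "\<dots> = K * max 0 v * (q' - q)" by simp
  finally show "price H v q - price H v q' \<le> K * max 0 v * (q' - q)" .
qed

lemma dual_update_ge:
  assumes H: "profile H" and q: "0 \<le> q"
  shows "dual H \<le> dual (update q v H)"
  unfolding dual_def
proof (rule set_integral_mono)
  show "exp_drop f - exp_drop (H u) \<le> exp_drop f - exp_drop (update q v H u)" for u
    using exp_drop_advance_le[OF profile_good[OF H, of u] q] exp_drop_gap_le(1)[OF profile_good[OF H, of u] q]
    by (simp add: update_def)
qed (intro integrable_dual profile.update H q)+

text \<open>Level by level: at \<open>u \<le> v\<close> both sides agree by the definition of
  \<open>exp_drop\<close>; at \<open>u > v\<close> nothing is won, and the dual grows by at most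
  \<open>q * gap_cost (H u)\<close>.\<close>

lemma won_update_ge:
  assumes H: "profile H" and q: "0 \<le> q"
  shows "dual (update q v H) - dual H + gain H v q \<le> won (update q v H) - won H"
proof -
  let ?H = "update q v H"
  have H': "profile ?H" by (rule profile.update[OF H q])
  let ?g = "\<lambda>u. if u \<le> v then exp_mean (H u) - exp_mean (advance q (H u)) else - q * gap_cost (H u)"
  let ?d = "\<lambda>u. (exp_drop f - exp_drop (?H u)) - (exp_drop f - exp_drop (H u))"
  let ?w = "\<lambda>u. (1 - ?H u 0) - (1 - H u 0)"
  have d: "set_integrable lborel {0<..} ?d" "dual ?H - dual H = (LINT u:{0<..}|lborel. ?d u)"
    unfolding dual_def using integrable_dual[OF H] integrable_dual[OF H']
    by (simp_all only: set_integral_diff)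
  have w: "set_integrable lborel {0<..} ?w" "won ?H - won H = (LINT u:{0<..}|lborel. ?w u)"
    unfolding won_def using integrable_won[OF H] integrable_won[OF H']
    by (simp_all only: set_integral_diff)
  have "dual ?H - dual H + gain H v q = (LINT u:{0<..}|lborel. ?d u + ?g u)"
    unfolding d(2) gain_def by (rule set_integral_add(2)[symmetric, OF d(1) integrable_gain[OF H]])
  also have "\<dots> \<le> (LINT u:{0<..}|lborel. ?w u)"
  proof (rule set_integral_mono[OF set_integral_add(1)[OF d(1) integrable_gain[OF H]] w(1)])
    fix u
    show "?d u + ?g u \<le> ?w u"
      using exp_drop_gap_le(2)[OF profile_good[OF H, of u] q]
      by (auto simp: update_def gap_cost_def exp_drop_def[of "H u"] exp_drop_def[of "advance q (H u)"] algebra_simps)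
  qed
  finally show ?thesis unfolding w(2) .
qed

text \<open>At levels \<open>u \<le> v\<close> the price is exactly what the updated dual lacks to
  reach \<open>exp_drop f\<close>. At higher levels the sum is nonnegative because the dual value
  covers \<open>gap_cost\<close>, which is what \<open>good\<close> maintains.\<close>

lemma dual_plus_price_ge:
  assumes H: "profile H" and q: "0 \<le> q" and v: "0 \<le> v"
  shows "exp_drop f * v \<le> dual (update q v H) + price H v q"
proof -
  let ?H = "update q v H"
  have H': "profile ?H" by (rule profile.update[OF H q])
  let ?p = "\<lambda>u. if u \<le> v then exp_drop (advance q (H u)) else - gap_cost (H u)"
  have "exp_drop f * v = (LINT u|lborel. exp_drop f * indicator {0<..v} u)"
    using v by simp
  also have "\<dots> = (LINT u:{0<..}|lborel. if u \<le> v then exp_drop f else 0)"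
    unfolding set_lebesgue_integral_def by (intro Bochner_Integration.integral_cong) (auto simp: indicator_def)
  also have "\<dots> \<le> (LINT u:{0<..}|lborel. (exp_drop f - exp_drop (?H u)) + ?p u)"
  proof (rule set_integral_mono[OF _ set_integral_add(1)[OF integrable_dual[OF H'] integrable_price[OF H]]])
    show "set_integrable lborel {0<..} (\<lambda>u. if u \<le> v then exp_drop f else 0)"
      using profile_integrable[OF H, of "\<lambda>_. 0" v "\<lambda>_. exp_drop f"] by simp
    fix u
    show "(if u \<le> v then exp_drop f else 0) \<le> (exp_drop f - exp_drop (?H u)) + ?p u"
      using gap_cost_le[OF profile_good[OF H, of u]] exp_drop_gap_le(1)[OF profile_good[OF H, of u] q]
      by (auto simp: update_def gap_cost_def)
  qed
  also have "\<dots> = dual ?H + price H v q"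
    unfolding dual_def price_def by (rule set_integral_add(2)[OF integrable_dual[OF H'] integrable_price[OF H]])
  finally show ?thesis .
qed

text \<open>The extra element \<open>d\<close>, which stands for leaving the online vertex unassigned, contributes
  nothing to the objective; it makes the optimal value nonnegative.\<close>
definition objective :: "'a set \<Rightarrow> ('a \<Rightarrow> real) \<Rightarrow> ('a \<Rightarrow> real \<Rightarrow> real \<Rightarrow> real) \<Rightarrow> ('a \<Rightarrow> real) \<Rightarrow> real" where
  "objective L w S p = (\<Sum>i\<in>L. gain (S i) (w i) (p i))"

definition allot :: "'a set \<Rightarrow> 'a \<Rightarrow> ('a \<Rightarrow> real) \<Rightarrow> ('a \<Rightarrow> real \<Rightarrow> real \<Rightarrow> real) \<Rightarrow> 'a \<Rightarrow> real" where
  "allot L d w S = (SOME p. p \<in> prob_vectors (insert d L) \<and>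
     (\<forall>p'\<in>prob_vectors (insert d L). objective L w S p' \<le> objective L w S p))"

section \<open>The optimal allotment\<close>

lemma gain_continuous:
  assumes H: "profile H"
  shows "continuous_on {0..1} (gain H v)"
proof (rule lipschitz_on_continuous_on)
  let ?C = "\<bar>price H v 0\<bar> + K * max 0 v"
  have C: "0 \<le> K * max 0 v" using K_nonneg by simp
  have *: "\<bar>gain H v y - gain H v x\<bar> \<le> ?C * (y - x)" if "0 \<le> x" "x \<le> y" "y \<le> 1" for x y
  proof -
    have "\<bar>price H v z\<bar> \<le> ?C" if "0 \<le> z" "z \<le> 1" for z
    proof -
      have "K * max 0 v * (z - 0) \<le> K * max 0 v * 1"
        using C that by (intro mult_left_mono) auto
      then show ?thesis using price_bounds[OF H order_refl that(1), of v] C by linarith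
    qed
    then have p: "\<bar>price H v x\<bar> \<le> ?C" "\<bar>price H v y\<bar> \<le> ?C" using that by auto
    have "(y - x) * (- ?C) \<le> (y - x) * price H v y" "(y - x) * price H v x \<le> (y - x) * ?C"
      using p that by (auto intro!: mult_left_mono)
    then show ?thesis
      using gain_bounds[OF H that(1,2), of v] unfolding mult.commute[of ?C] mult_minus_right by linarith
  qed
  show "?C-lipschitz_on {0..1} (gain H v)"
  proof (rule lipschitz_onI)
    show "dist (gain H v x) (gain H v y) \<le> ?C * dist x y" if "x \<in> {0..1}" "y \<in> {0..1}" for x y
    proof (cases "x \<le> y")
      case True
      then show ?thesis using *[of x y] that by (simp add: dist_real_def abs_minus_commute)
    next
      case False
      then show ?thesis using *[of y x] that by (simp add: dist_real_def)
    qed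
  qed (use C in simp)
qed

lemma allot_optimal:
  assumes L: "finite L" and S: "\<And>i. i \<in> L \<Longrightarrow> profile (S i)"
  shows "allot L d w S \<in> prob_vectors (insert d L)"
    and "p' \<in> prob_vectors (insert d L) \<Longrightarrow> objective L w S p' \<le> objective L w S (allot L d w S)"
proof -
  let ?P = "prob_vectors (insert d L)"
  have fin: "finite (insert d L)" using L by simp
  have "continuous_on ?P (objective L w S)"
    unfolding objective_def
  proof (intro continuous_on_sum)
    fix i assume "i \<in> L"
    show "continuous_on ?P (\<lambda>p. gain (S i) (w i) (p i))"
      by (rule continuous_on_compose2[OF gain_continuous[OF S[OF \<open>i \<in> L\<close>]]])
        (use prob_vectors_ge_0 prob_vectors_le_1[OF _ fin] in
          \<open>auto intro: continuous_on_subset[OF continuous_on_product_coordinates]\<close>)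
  qed
  moreover have "?P \<noteq> {}" using point_mass_prob_vectors[OF fin, of d] by auto
  ultimately have "\<exists>p. p \<in> ?P \<and> (\<forall>p'\<in>?P. objective L w S p' \<le> objective L w S p)"
    using continuous_attains_sup[OF compact_prob_vectors[OF fin]] by blast
  from someI_ex[OF this] show "allot L d w S \<in> ?P"
    and "p' \<in> ?P \<Longrightarrow> objective L w S p' \<le> objective L w S (allot L d w S)"
    unfolding allot_def by blast+
qed

text \<open>First-order optimality. Instead of differentiating under the integral, the proof uses that
  \<open>price\<close> is a Lipschitz continuous supergradient of \<open>gain\<close>.\<close>
lemma allot_variational:
  fixes w :: "'a \<Rightarrow> real"
  assumes L: "finite L" and S: "\<And>i. i \<in> L \<Longrightarrow> profile (S i)" and p': "p' \<in> prob_vectors (insert d L)"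
  defines "p \<equiv> allot L d w S"
  shows "(\<Sum>i\<in>L. (p' i - p i) * price (S i) (w i) (p i)) \<le> 0"
proof -
  let ?X = "\<Sum>i\<in>L. (p' i - p i) * price (S i) (w i) (p i)"
  let ?Y = "\<Sum>i\<in>L. K * max 0 (w i) * (p' i - p i)\<^sup>2"
  have p: "p \<in> prob_vectors (insert d L)" unfolding p_def by (rule allot_optimal(1)[OF L S])
  \<comment> \<open>Moving from \<open>p\<close> towards \<open>p'\<close> by \<open>e\<close>
    cannot improve the optimum; the Lipschitz bound on \<open>price\<close> turns this into a
    first-order term \<open>?X\<close> with a second-order error.\<close>
  have "?X \<le> e * ?Y" if e: "0 < e" "e \<le> 1" for e
  proof -
    define z where "z i = p i + e * (p' i - p i)" for i
    have z: "z \<in> prob_vectors (insert d L)"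
      unfolding z_def using prob_vectors_convex[OF p p'] e by simp
    have step: "e * ((p' i - p i) * price (S i) (w i) (p i) - e * (K * max 0 (w i) * (p' i - p i)\<^sup>2))
        \<le> gain (S i) (w i) (z i) - gain (S i) (w i) (p i)" if "i \<in> L" for i
    proof -
      have pos: "0 \<le> p i" "0 \<le> z i" using prob_vectors_ge_0[OF p] prob_vectors_ge_0[OF z] by auto
      have zp: "z i - p i = e * (p' i - p i)" by (simp add: z_def)
      have "(z i - p i) * price (S i) (w i) (p i) - K * max 0 (w i) * (z i - p i)\<^sup>2
          \<le> gain (S i) (w i) (z i) - gain (S i) (w i) (p i)"
      proof (cases "p i \<le> z i")
        case True
        have "(z i - p i) * (price (S i) (w i) (p i) - K * max 0 (w i) * (z i - p i)) \<le> (z i - p i) * price (S i) (w i) (z i)"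
          using True price_bounds(2)[OF S[OF that] pos(1) True, of "w i"] by (intro mult_left_mono) auto
        then show ?thesis
          using gain_bounds(1)[OF S[OF that] pos(1) True, of "w i"] by (simp add: algebra_simps power2_eq_square)
      next
        case False
        then have le: "z i \<le> p i" by simp
        have "(p i - z i) * price (S i) (w i) (z i) \<le> (p i - z i) * (price (S i) (w i) (p i) + K * max 0 (w i) * (p i - z i))"
          using le price_bounds(2)[OF S[OF that] pos(2) le, of "w i"] by (intro mult_left_mono) auto
        then show ?thesis
          using gain_bounds(2)[OF S[OF that] pos(2) le, of "w i"] by (simp add: algebra_simps power2_eq_square)
      qed
      then show ?thesis unfolding zp by (simp add: algebra_simps power2_eq_square)
    qed
    have "e * (?X - e * ?Y) = (\<Sum>i\<in>L. e * ((p' i - p i) * price (S i) (w i) (p i) - e * (K * max 0 (w i) * (p' i - p i)\<^sup>2)))"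
      by (simp only: sum_distrib_left sum_subtractf right_diff_distrib)
    also have "\<dots> \<le> (\<Sum>i\<in>L. gain (S i) (w i) (z i) - gain (S i) (w i) (p i))"
      by (rule sum_mono) (rule step)
    also have "\<dots> = objective L w S z - objective L w S p"
      by (simp add: objective_def sum_subtractf)
    also have "\<dots> \<le> 0"
      using allot_optimal(2)[OF L S z, where w = w] by (simp add: p_def)
    finally have "e * (?X - e * ?Y) \<le> 0" .
    then show ?thesis using e by (simp add: mult_le_0_iff)
  qed
  note bound = this
  show ?thesis
  proof (rule ccontr)
    assume "\<not> ?X \<le> 0"
    then have X: "0 < ?X" by simp
    have Y: "0 \<le> ?Y" using K_nonneg by (intro sum_nonneg) auto
    \<comment> \<open>This size makes \<open>e * ?Y\<close> at most half of \<open>?X\<close>; the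
      \<open>+ 1\<close> guards against \<open>?Y = 0\<close>.\<close>
    define e where "e = min 1 (?X / (2 * (?Y + 1)))"
    have "0 < e" "e \<le> 1" using X Y by (auto simp: e_def)
    then have "?X \<le> e * ?Y" by (rule bound)
    also have "\<dots> \<le> ?X / (2 * (?Y + 1)) * ?Y" using Y by (intro mult_right_mono) (auto simp: e_def)
    also have "\<dots> \<le> ?X / (2 * (?Y + 1)) * (?Y + 1)" using X Y by (intro mult_left_mono) auto
    also have "\<dots> = ?X / 2" using Y by (simp add: field_simps)
    finally show False using X by simp
  qed
qed

text \<open>Comparing \<open>p\<close> with the point mass at \<open>k\<close> bounds the price at
  \<open>k\<close> by the \<open>p\<close>-average of the prices, and concavity with
  \<open>gain\<close> zero at mass \<open>0\<close> bounds that average by the objective. The point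
  mass at \<open>d\<close> gives nonnegativity.\<close>

lemma objective_allot_ge:
  fixes w :: "'a \<Rightarrow> real"
  assumes L: "finite L" and S: "\<And>i. i \<in> L \<Longrightarrow> profile (S i)" and d: "d \<notin> L"
  defines "p \<equiv> allot L d w S"
  shows "0 \<le> objective L w S p" and "k \<in> L \<Longrightarrow> price (S k) (w k) (p k) \<le> objective L w S p"
proof -
  let ?\<pi> = "\<lambda>i. price (S i) (w i) (p i)"
  have p: "p \<in> prob_vectors (insert d L)" unfolding p_def by (rule allot_optimal(1)[OF L S])
  have "(\<Sum>i\<in>L. p i * ?\<pi> i) \<le> objective L w S p"
    unfolding objective_def
  proof (rule sum_mono)
    fix i assume "i \<in> L"
    show "p i * ?\<pi> i \<le> gain (S i) (w i) (p i)"
      using gain_bounds(1)[OF S[OF \<open>i \<in> L\<close>] order_refl prob_vectors_ge_0[OF p, of i], of "w i"] by simp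
  qed
  moreover have *: "(\<Sum>i\<in>L. (if i = k then 1 else 0) * ?\<pi> i) \<le> (\<Sum>i\<in>L. p i * ?\<pi> i)" if "k \<in> insert d L" for k
  proof -
    have "(\<lambda>i. if i = k then 1 else 0) \<in> prob_vectors (insert d L)"
      using L that by (intro point_mass_prob_vectors) auto
    from allot_variational[where S = S and w = w, OF L S this] show ?thesis
      by (simp add: p_def[symmetric] left_diff_distrib sum_subtractf)
  qed
  have "0 \<le> (\<Sum>i\<in>L. p i * ?\<pi> i)"
  proof -
    have "(\<Sum>i\<in>L. (if i = d then 1 else 0) * ?\<pi> i) = 0"
      using d by (intro sum.neutral) auto
    then show ?thesis using *[of d] by simp
  qed
  moreover have "?\<pi> k \<le> (\<Sum>i\<in>L. p i * ?\<pi> i)" if "k \<in> L"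
  proof -
    have "(\<Sum>i\<in>L. (if i = k then 1 else 0) * ?\<pi> i) = (\<Sum>i\<in>L. if i = k then ?\<pi> i else 0)"
      by (intro sum.cong) auto
    also have "\<dots> = ?\<pi> k" using that L by simp
    finally show ?thesis using *[of k] that by simp
  qed
  ultimately show "0 \<le> objective L w S p" and "k \<in> L \<Longrightarrow> ?\<pi> k \<le> objective L w S p"
    by (auto intro: order_trans)
qed

primrec profiles :: "'a set \<Rightarrow> 'a \<Rightarrow> (nat \<Rightarrow> 'a \<Rightarrow> real) \<Rightarrow> nat \<Rightarrow> 'a \<Rightarrow> real \<Rightarrow> real \<Rightarrow> real" where
  "profiles L d W 0 = (\<lambda>i u. f)"
| "profiles L d W (Suc n) =
     (\<lambda>i. update (allot L d (W n) (profiles L d W n) i) (W n i) (profiles L d W n i))"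

definition offer :: "'a set \<Rightarrow> 'a \<Rightarrow> (nat \<Rightarrow> 'a \<Rightarrow> real) \<Rightarrow> nat \<Rightarrow> 'a \<Rightarrow> real" where
  "offer L d W n = allot L d (W n) (profiles L d W n)"

lemma profiles_Suc: "profiles L d W (Suc n) i = update (offer L d W n i) (W n i) (profiles L d W n i)"
  by (simp add: offer_def)

lemma profiles_cong: "(\<And>m. m < n \<Longrightarrow> W m = W' m) \<Longrightarrow> profiles L d W n = profiles L d W' n"
  by (induction n) auto

text \<open>This makes the algorithm online: it can recompute every offer from the prefix of the
  input that has arrived.\<close>

lemma offer_cong: "(\<And>m. m \<le> n \<Longrightarrow> W m = W' m) \<Longrightarrow> offer L d W n = offer L d W' n"
  unfolding offer_def using profiles_cong[of n W W' L d] by simp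

section \<open>Dual feasibility and weak duality\<close>

context
  fixes L :: "'a set" and d :: 'a and W :: "nat \<Rightarrow> 'a \<Rightarrow> real"
  assumes L: "finite L" and d: "d \<notin> L"
begin

lemma profile_profiles: "profile (profiles L d W n i)"
proof (induction n arbitrary: i)
  case (Suc n)
  show ?case
    unfolding profiles_Suc offer_def
    using Suc prob_vectors_ge_0[OF allot_optimal(1)[OF L Suc]] by (intro profile.update)
qed (simp add: profile.init)

lemma offer_prob_vectors: "offer L d W n \<in> prob_vectors (insert d L)"
  unfolding offer_def by (rule allot_optimal(1)[OF L profile_profiles])

lemma offer_nonneg: "0 \<le> offer L d W n i"
  by (rule prob_vectors_ge_0[OF offer_prob_vectors])

lemma dual_profiles_mono: "m \<le> n \<Longrightarrow> dual (profiles L d W m i) \<le> dual (profiles L d W n i)"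
proof (induction n rule: dec_induct)
  case (step n)
  then show ?case
    unfolding profiles_Suc by (intro order_trans[OF step(3)] dual_update_ge profile_profiles offer_nonneg)
qed simp

definition online_dual :: "nat \<Rightarrow> real" where
  "online_dual n = objective L (W n) (profiles L d W n) (offer L d W n)"

lemma online_dual_nonneg: "0 \<le> online_dual n"
  unfolding online_dual_def offer_def by (rule objective_allot_ge(1)[OF L profile_profiles d])

text \<open>\<open>won_update_ge\<close> summed over vertices and steps: the gains of a step add up
  to its online dual value.\<close>

lemma sum_dual_le_won:
  "(\<Sum>i\<in>L. dual (profiles L d W n i)) + (\<Sum>m<n. online_dual m) \<le> (\<Sum>i\<in>L. won (profiles L d W n i))"
proof (induction n)
  case (Suc n)
  have "(\<Sum>i\<in>L. dual (profiles L d W (Suc n) i) - dual (profiles L d W n i)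
        + gain (profiles L d W n i) (W n i) (offer L d W n i))
      \<le> (\<Sum>i\<in>L. won (profiles L d W (Suc n) i) - won (profiles L d W n i))"
    unfolding profiles_Suc by (intro sum_mono won_update_ge profile_profiles offer_nonneg)
  then show ?case
    using Suc by (simp add: sum.distrib sum_subtractf online_dual_def objective_def del: profiles.simps)
qed simp

text \<open>The edge is covered when \<open>j\<close> arrives, by \<open>dual_plus_price_ge\<close>
  and the optimality of the offer; afterwards the dual value of \<open>i\<close> only grows.\<close>

lemma edge_covered:
  assumes "i \<in> L" "j < n" "0 \<le> W j i"
  shows "exp_drop f * W j i \<le> dual (profiles L d W n i) + online_dual j"
proof -
  have "exp_drop f * W j i \<le> dual (profiles L d W (Suc j) i) + price (profiles L d W j i) (W j i) (offer L d W j i)"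
    unfolding profiles_Suc by (rule dual_plus_price_ge[OF profile_profiles offer_nonneg assms(3)])
  also have "\<dots> \<le> dual (profiles L d W n i) + online_dual j"
    using assms(1,2) unfolding online_dual_def offer_def
    by (intro add_mono dual_profiles_mono objective_allot_ge(2)[OF L profile_profiles d]) auto
  finally show ?thesis .
qed

text \<open>Weak duality: a matching uses each vertex at most once and dual values are nonnegative,
  so the covering inequalities sum to at most the total dual value.\<close>

lemma matching_weight_le_won:
  assumes E: "bip_matching L n E" and W: "\<And>j i. j < n \<Longrightarrow> i \<in> L \<Longrightarrow> 0 \<le> W j i"
  shows "exp_drop f * (\<Sum>(i, j)\<in>E. W j i) \<le> (\<Sum>i\<in>L. won (profiles L d W n i))"
proof -
  let ?a = "\<lambda>i. dual (profiles L d W n i)"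
  have sub: "E \<subseteq> L \<times> {..<n}" and inj: "inj_on fst E" "inj_on snd E"
    using E by (auto simp: bip_matching_def)
  have a: "0 \<le> ?a i" for i using dual_profiles_mono[of 0 n i] by simp
  have "exp_drop f * (\<Sum>(i, j)\<in>E. W j i) = (\<Sum>e\<in>E. exp_drop f * W (snd e) (fst e))"
    by (simp add: sum_distrib_left case_prod_beta)
  also have "\<dots> \<le> (\<Sum>e\<in>E. ?a (fst e) + online_dual (snd e))"
    using sub W by (intro sum_mono edge_covered) auto
  also have "\<dots> = (\<Sum>i\<in>fst ` E. ?a i) + (\<Sum>j\<in>snd ` E. online_dual j)"
    by (simp add: sum.distrib sum.reindex inj)
  also have "\<dots> \<le> (\<Sum>i\<in>L. ?a i) + (\<Sum>j<n. online_dual j)"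
    using sub L a online_dual_nonneg by (intro add_mono sum_mono2) auto
  also have "\<dots> \<le> (\<Sum>i\<in>L. won (profiles L d W n i))" by (rule sum_dual_le_won)
  finally show ?thesis .
qed

end

end

section \<open>Reduction to the OCS\<close>

lemma consecutive_bound_Ico:
  assumes "consecutive_bound f F" "a < b" "\<And>j. q j \<in> {0..1}"
  shows "F {a..<b} q \<le> f (\<Sum>j=a..<b. q j)"
proof -
  have "{a..<b} = {a..b - 1}" using assms(2) by auto
  then show ?thesis
    using assms unfolding consecutive_bound_def by simp
qed

section \<open>Bounding an OCS by a run of states\<close>

context ocs_rate
begin

primrec run :: "(nat \<Rightarrow> real) \<Rightarrow> nat set \<Rightarrow> nat \<Rightarrow> real \<Rightarrow> real" where
  "run q I 0 = f"
| "run q I (Suc n) = (if n \<in> I then advance (q n) (run q I n) else gap (q n) (run q I n))"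

lemma profiles_eq_run: "profiles L d W n i u = run (\<lambda>m. offer L d W m i) {m. u \<le> W m i} n"
  by (induction n) (simp_all add: update_def offer_def)

lemma run_cong: "(\<And>m. m < n \<Longrightarrow> q m = q' m) \<Longrightarrow> run q I n = run q' I n"
  by (induction n) auto

lemma run_disjoint: "I \<inter> {..<n} = {} \<Longrightarrow> run q I n = f"
proof (induction n)
  case (Suc n)
  then have "I \<inter> {..<n} = {}" "n \<notin> I" by auto
  then show ?case using Suc.IH by simp
qed simp

lemma good_run: "(\<And>m. 0 \<le> q m) \<Longrightarrow> good (run q I n)"
  by (induction n) (auto simp: good_f good_advance good_gap)

text \<open>The value of \<open>F\<close> at the empty set is not controlled by any assumption.\<close>
lemma OCS_bound_le_run:
  assumes cons: "consecutive_bound f F" and gaps: "ignores_small_gaps r F"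
    and nonneg: "\<And>S q. (\<And>j. q j \<in> {0..1}) \<Longrightarrow> 0 \<le> F S q"
  shows "(\<And>j. q j \<in> {0..1}) \<Longrightarrow> n \<le> m \<Longrightarrow> I \<inter> {..<n} \<union> {n..<m} \<noteq> {} \<Longrightarrow>
    F (I \<inter> {..<n} \<union> {n..<m}) q \<le> run q I n (\<Sum>j=n..<m. q j)"
\<comment> \<open>The steps \<open>{n..<m}\<close> form a consecutive block. In the induction step,
  step \<open>n\<close> either joins the front of the block or is a gap before it. Both
  \<open>q\<close> and \<open>m\<close> vary because deleting a gap shifts the later steps.\<close>
proof (induction n arbitrary: q m)
  case 0
  then show ?case using consecutive_bound_Ico[OF cons, of 0 m q] by simp
next
  case (Suc n)
  note consec = consecutive_bound_Ico[OF cons _ Suc.prems(1)]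
  let ?S = "I \<inter> {..<n}" and ?T = "{Suc n..<m}"
  show ?case
  proof (cases "n \<in> I")
    case True
    have "{n..<m} = insert n ?T" using Suc.prems(2) by auto
    then have "I \<inter> {..<Suc n} \<union> ?T = ?S \<union> {n..<m}" using True by (auto simp: lessThan_Suc)
    moreover have "(\<Sum>j=n..<m. q j) = q n + (\<Sum>j=Suc n..<m. q j)"
      using Suc.prems(2) by (intro sum.atLeast_Suc_lessThan) simp
    ultimately show ?thesis
      using Suc.IH[of q m] Suc.prems True by (simp add: advance_def)
  next
    case False
    then have S: "I \<inter> {..<Suc n} = ?S" by (auto simp: less_Suc_eq)
    show ?thesis
    \<comment> \<open>With an empty block there is no gap to delete, and \<open>gap\<close> does not
      alter the value at \<open>0\<close>.\<close>
    proof (cases "m = Suc n")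
      case True
      then show ?thesis using Suc.IH[of q n] Suc.prems False S by simp
    next
      case m: False
      then have "Suc n < m" using Suc.prems(2) by simp
      show ?thesis
      \<comment> \<open>Without an earlier relevant step the block stands alone: condition (b)
        applies, and the state is still \<open>f\<close>.\<close>
      proof (cases "?S = {}")
        case True
        then show ?thesis using consec[OF \<open>Suc n < m\<close>] run_disjoint[of I n q] False S by simp
      next
        case ne: False
        let ?q' = "del_seq n q" and ?w = "keep (q n)" and ?s = "\<Sum>j=Suc n..<m. q j"
        have q': "\<And>j. ?q' j \<in> {0..1}" using Suc.prems(1) by (simp add: del_seq_def)
        have w: "0 \<le> ?w" "?w \<le> 1"
          using keep_nonneg keep_le_1[of "q n"] Suc.prems(1)[of n] by auto
        have img: "(\<lambda>j. j - 1) ` ?T = {n..<m - 1}"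
        proof (intro set_eqI iffI)
          fix x assume "x \<in> {n..<m - 1}"
          then have "x = Suc x - 1" "Suc x \<in> ?T" by auto
          then show "x \<in> (\<lambda>j. j - 1) ` ?T" by blast
        qed auto
        have "(\<Sum>j=n..<m - 1. ?q' j) = (\<Sum>j=n..<m - 1. q (Suc j))"
          by (intro sum.cong) (auto simp: del_seq_def)
        also have "\<dots> = (\<Sum>j=Suc n..<Suc (m - 1). q j)"
          by (rule sum.shift_bounds_Suc_ivl[symmetric])
        also have "Suc (m - 1) = m" using \<open>Suc n < m\<close> by simp
        finally have sum': "(\<Sum>j=n..<m - 1. ?q' j) = ?s" .
        have "F (?S \<union> ?T) q \<le> ?w * F (?S \<union> (\<lambda>j. j - 1) ` ?T) ?q' + (1 - ?w) * (F ?S q * F ?T q)"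
          using gaps Suc.prems(1) unfolding ignores_small_gaps_def Let_def keep_def by auto
        also have "\<dots> \<le> ?w * run q I n ?s + (1 - ?w) * (run q I n 0 * f ?s)"
        proof (intro add_mono mult_left_mono mult_mono)
          have "F (?S \<union> {n..<m - 1}) ?q' \<le> run ?q' I n (\<Sum>j=n..<m - 1. ?q' j)"
            by (rule Suc.IH) (use q' \<open>Suc n < m\<close> ne in auto)
          then have "F (?S \<union> (\<lambda>j. j - 1) ` ?T) ?q' \<le> run ?q' I n ?s"
            unfolding img sum' .
          also have "run ?q' I n = run q I n"
            by (rule run_cong) (simp add: del_seq_def)
          finally show "F (?S \<union> (\<lambda>j. j - 1) ` ?T) ?q' \<le> run q I n ?s" .
          show "F ?S q \<le> run q I n 0"
            using Suc.IH[of q n] Suc.prems(1) ne by simp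
          show "F ?T q \<le> f ?s" by (rule consec) fact
          show "0 \<le> run q I n 0"
            using goodD(4)[OF good_run[of q I n], of 0] Suc.prems(1) by simp
          show "0 \<le> F ?T q" using nonneg Suc.prems(1) by blast
        qed (use w in auto)
        finally show ?thesis
          using False S by (simp add: gap_def)
      qed
    qed
  qed
qed

end

text \<open>Layer-cake: the expectation is the integral over \<open>u > 0\<close> of the probability
  of \<open>u \<le> X\<close>, by Fubini for the indicator of the region below the graph of
  \<open>X\<close>.\<close>

lemma (in prob_space) integral_le_expectation:
  assumes X: "integrable M X" "\<And>\<omega>. \<omega> \<in> space M \<Longrightarrow> 0 \<le> X \<omega>"
    and \<phi>: "set_integrable lborel {0<..} \<phi>" "\<And>u. 0 \<le> \<phi> u"
    and le: "\<And>u. 0 < u \<Longrightarrow> \<phi> u \<le> prob {\<omega> \<in> space M. u \<le> X \<omega>}"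
  shows "(LINT u:{0<..}|lborel. \<phi> u) \<le> expectation X"
proof -
  interpret pair_sigma_finite M lborel ..
  have [measurable]: "X \<in> borel_measurable M" using X(1) by simp
  let ?g = "\<lambda>(\<omega>, u). indicator {p. 0 < snd p \<and> snd p \<le> X (fst p)} (\<omega>, u) :: ennreal"
  have meas: "?g \<in> borel_measurable (M \<Otimes>\<^sub>M lborel)"
    unfolding indicator_def by measurable
  have "ennreal (LINT u:{0<..}|lborel. \<phi> u) = (\<integral>\<^sup>+u. ennreal (indicator {0<..} u *\<^sub>R \<phi> u) \<partial>lborel)"
    unfolding set_lebesgue_integral_def using \<phi>
    by (intro nn_integral_eq_integral[symmetric]) (auto simp: set_integrable_def)
  also have "\<dots> \<le> (\<integral>\<^sup>+u. (\<integral>\<^sup>+\<omega>. ?g (\<omega>, u) \<partial>M) \<partial>lborel)"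
  proof (rule nn_integral_mono)
    fix u :: real
    show "ennreal (indicator {0<..} u *\<^sub>R \<phi> u) \<le> (\<integral>\<^sup>+\<omega>. ?g (\<omega>, u) \<partial>M)"
    proof (cases "0 < u")
      case True
      have "(\<integral>\<^sup>+\<omega>. ?g (\<omega>, u) \<partial>M) = (\<integral>\<^sup>+\<omega>. indicator {\<omega> \<in> space M. u \<le> X \<omega>} \<omega> \<partial>M)"
        using True by (intro nn_integral_cong) (auto simp: indicator_def)
      also have "\<dots> = ennreal (prob {\<omega> \<in> space M. u \<le> X \<omega>})"
        by (simp add: emeasure_eq_measure)
      finally show ?thesis using True le[OF True] by (simp add: ennreal_leI)
    qed simp
  qed
  also have "\<dots> = (\<integral>\<^sup>+\<omega>. (\<integral>\<^sup>+u. ?g (\<omega>, u) \<partial>lborel) \<partial>M)"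
    by (rule Fubini) (rule meas)
  also have "\<dots> = (\<integral>\<^sup>+\<omega>. ennreal (X \<omega>) \<partial>M)"
  proof (rule nn_integral_cong)
    fix \<omega> assume "\<omega> \<in> space M"
    have "(\<integral>\<^sup>+u. ?g (\<omega>, u) \<partial>lborel) = (\<integral>\<^sup>+u. indicator {0<..X \<omega>} u \<partial>lborel)"
      by (intro nn_integral_cong) (auto simp: indicator_def)
    also have "\<dots> = ennreal (X \<omega>)" using X(2)[OF \<open>\<omega> \<in> space M\<close>] by simp
    finally show "(\<integral>\<^sup>+u. ?g (\<omega>, u) \<partial>lborel) = ennreal (X \<omega>)" .
  qed
  also have "\<dots> = ennreal (expectation X)"
    using X by (intro nn_integral_eq_integral) auto
  finally show ?thesis
    using X(2) by (simp add: ennreal_le_iff integral_nonneg_AE)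
qed

text \<open>If all mass is put on one of \<open>n + 1\<close> elements, then each of the \<open>n\<close> others still wins with
  probability at least \<open>1 - f 0\<close>.\<close>
lemma fr_continuous_OCS_f_0:
  fixes M :: "'a::infinite set \<Rightarrow> 'w measure"
  assumes OCS: "fr_continuous_OCS f r M A" and f: "f 0 \<le> 1"
  shows "f 0 = 1"
proof (rule ccontr)
  assume "f 0 \<noteq> 1"
  with f have pos: "0 < 1 - f 0" by simp
  \<comment> \<open>With this many other elements, their disjoint winning events at one step would
    have total probability above \<open>1\<close>.\<close>
  then obtain n where n: "1 < real n * (1 - f 0)"
    using reals_Archimedean3[of "1 - f 0"] by blast
  obtain L :: "'a set" where L: "finite L" "card L = Suc n"
    using infinite_arbitrarily_large[OF infinite_UNIV] by blast
  then obtain k where k: "k \<in> L" by fastforce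
  define p where "p = (\<lambda>i. if i = k then 1 else 0 :: real)"
  have p: "p \<in> prob_vectors L"
    unfolding p_def by (rule point_mass_prob_vectors[OF L(1) k])
  have ocs: "continuous_OCS M A" using OCS by (simp add: fr_continuous_OCS_def)
  obtain F where F: "OCS_never_wins_bound L (M L) (A L) F" "consecutive_bound f F"
    using OCS L k unfolding fr_continuous_OCS_def by blast
  have "prob_space (M L)" using ocs L k unfolding continuous_OCS_def by blast
  then interpret prob_space "M L" .
  have meas: "(\<lambda>\<omega>. A L \<omega> [p]) \<in> M L \<rightarrow>\<^sub>M count_space L"
    using ocs L k p unfolding continuous_OCS_def by auto
  define E where "E i = {\<omega> \<in> space (M L). A L \<omega> [p] = i}" for i
  have E: "E i \<in> events" if "i \<in> L" for i
    unfolding E_def using measurable_sets[OF meas, of "{i}"] that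
    by (simp add: vimage_def Int_def conj_commute)
  have "1 - f 0 \<le> prob (E i)" if "i \<in> L - {k}" for i
  proof -
    have "prob (space (M L) - E i) = prob {\<omega> \<in> space (M L). \<forall>j\<in>{0}. A L \<omega> (map (\<lambda>_. p) [0..<Suc j]) \<noteq> i}"
      by (rule arg_cong[of _ _ prob]) (auto simp: E_def)
    also have "\<dots> \<le> F {0} (\<lambda>j. p i)"
    proof -
      have "(\<forall>j::nat. p \<in> prob_vectors L) \<and> i \<in> L" using p that by simp
      then show ?thesis
        using F(1)[unfolded OCS_never_wins_bound_def, rule_format, of "\<lambda>_. p" i "{0}"] by blast
    qed
    also have "\<dots> \<le> f 0"
    proof -
      have "F {0..0} (\<lambda>j. p i) \<le> f (\<Sum>j\<in>{0..0::nat}. p i)"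
        by (rule F(2)[unfolded consecutive_bound_def, rule_format, of "\<lambda>_. p i" 0 0]) (use that in \<open>simp add: p_def\<close>)
      then show ?thesis using that by (simp add: p_def)
    qed
    finally show ?thesis using E[of i] that by (simp add: prob_compl)
  qed
  then have "(\<Sum>i\<in>L - {k}. 1 - f 0) \<le> (\<Sum>i\<in>L - {k}. prob (E i))"
    by (rule sum_mono)
  also have "\<dots> = prob (\<Union>i\<in>L - {k}. E i)"
    using E L by (intro finite_measure_finite_Union[symmetric]) (auto simp: disjoint_family_on_def E_def)
  also have "\<dots> \<le> 1" by simp
  finally show False using n L k by simp
qed

text \<open>The OCS runs on \<open>insert d L\<close>: a win of the dummy \<open>d\<close> leaves
  the online vertex unassigned, and the ground set is nonempty even for
  \<open>L = {}\<close>.\<close>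

locale ocs_matching = ocs_rate f r K
  for f :: "real \<Rightarrow> real" and r K +
  fixes M :: "'a set \<Rightarrow> 'w measure" and A :: "'a set \<Rightarrow> 'w \<Rightarrow> ('a \<Rightarrow> real) list \<Rightarrow> 'a"
    and L :: "'a set" and d :: 'a
  assumes OCS: "fr_continuous_OCS f r M A" and finite_L: "finite L" and d: "d \<notin> L"
begin

definition assign :: "'w \<Rightarrow> ('a \<Rightarrow> real) list \<Rightarrow> 'a option" where
  "assign \<omega> ws = (let x = A (insert d L) \<omega> (map (offer L d (nth ws)) [0..<length ws])
     in if x = d then None else Some x)"

abbreviation "N \<equiv> M (insert d L)"

lemma continuous_OCS: "continuous_OCS M A"
  using OCS by (simp add: fr_continuous_OCS_def)

sublocale prob_space N
  using continuous_OCS finite_L unfolding continuous_OCS_def by blast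

lemma winner_measurable:
  "(\<lambda>\<omega>. A (insert d L) \<omega> (map (offer L d W) [0..<Suc j])) \<in> N \<rightarrow>\<^sub>M count_space (insert d L)"
proof -
  have "set (map (offer L d W) [0..<Suc j]) \<subseteq> prob_vectors (insert d L)"
    using offer_prob_vectors[OF finite_L d] by auto
  moreover have "map (offer L d W) [0..<Suc j] \<noteq> []" by simp
  ultimately show ?thesis
    using continuous_OCS finite_L unfolding continuous_OCS_def by blast
qed

lemma assign_measurable:
  assumes "ws \<noteq> []"
  shows "(\<lambda>\<omega>. assign \<omega> ws) \<in> N \<rightarrow>\<^sub>M count_space (insert None (Some ` L))"
proof -
  obtain j where "length ws = Suc j" using assms by (cases ws) auto
  then have "(\<lambda>\<omega>. assign \<omega> ws) =
      (\<lambda>x. if x = d then None else Some x) \<circ> (\<lambda>\<omega>. A (insert d L) \<omega> (map (offer L d (nth ws)) [0..<Suc j]))"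
    by (auto simp: assign_def Let_def simp del: upt_Suc)
  also have "\<dots> \<in> N \<rightarrow>\<^sub>M count_space (insert None (Some ` L))"
    by (rule measurable_comp[OF winner_measurable]) auto
  finally show ?thesis .
qed

lemma assign_take_iff:
  assumes "j < length ws" "i \<in> L"
  shows "assign \<omega> (take (Suc j) ws) = Some i \<longleftrightarrow>
    A (insert d L) \<omega> (map (offer L d (nth ws)) [0..<Suc j]) = i"
proof -
  have offers: "map (offer L d (nth (take (Suc j) ws))) [0..<Suc j] = map (offer L d (nth ws)) [0..<Suc j]"
    by (intro map_cong refl offer_cong) auto
  have len: "length (take (Suc j) ws) = Suc j" using assms(1) by simp
  show ?thesis
    unfolding assign_def Let_def len offers using assms(2) d by auto
qed

lemma never_wins_le:
  assumes "i \<in> L"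
  shows "prob {\<omega> \<in> space N. \<forall>j<n. u \<le> W j i \<longrightarrow> A (insert d L) \<omega> (map (offer L d W) [0..<Suc j]) \<noteq> i}
    \<le> profiles L d W n i u 0"
proof -
  let ?L = "insert d L" and ?I = "{m. u \<le> W m i}" and ?q = "\<lambda>m. offer L d W m i"
  let ?S = "?I \<inter> {..<n}"
  have fin: "finite ?L" "?L \<noteq> {}" using finite_L by auto
  have offer: "offer L d W j \<in> prob_vectors ?L" for j
    by (rule offer_prob_vectors[OF finite_L d])
  have q: "?q j \<in> {0..1}" for j
    using prob_vectors_ge_0[OF offer] prob_vectors_le_1[OF offer fin(1)] by simp
  obtain F where F: "OCS_never_wins_bound ?L N (A ?L) F" "consecutive_bound f F" "ignores_small_gaps r F"
    using OCS fin unfolding fr_continuous_OCS_def by blast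
  have win: "prob {\<omega> \<in> space N. \<forall>j\<in>S. A ?L \<omega> (map p [0..<Suc j]) \<noteq> i} \<le> F S (\<lambda>j. p j i)"
    if "\<And>j. p j \<in> prob_vectors ?L" for S p
    using F(1) that assms unfolding OCS_never_wins_bound_def by blast
  \<comment> \<open>Every sequence in \<open>[0, 1]\<close> occurs as the masses of \<open>i\<close>
    once the remaining mass goes to \<open>d\<close>, so \<open>F\<close> dominates a
    probability.\<close>
  have nonneg: "0 \<le> F S q" if "\<And>j. q j \<in> {0..1}" for S q
  proof -
    define p where "p j k = (if k = i then q j else if k = d then 1 - q j else 0)" for j k
    have "i \<noteq> d" using assms d by auto
    have "p j \<in> prob_vectors ?L" for j
    proof -
      have "(\<Sum>k\<in>?L. p j k) = p j d + (p j i + (\<Sum>k\<in>L - {i}. p j k))"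
        using finite_L d assms by (simp add: sum.remove[of L i])
      also have "(\<Sum>k\<in>L - {i}. p j k) = 0"
        using d by (intro sum.neutral) (auto simp: p_def)
      finally show ?thesis
        using that[of j] assms \<open>i \<noteq> d\<close> by (auto simp: prob_vectors_def p_def)
    qed
    then have "prob {\<omega> \<in> space N. \<forall>j\<in>S. A ?L \<omega> (map p [0..<Suc j]) \<noteq> i} \<le> F S (\<lambda>j. p j i)"
      by (rule win)
    then have "0 \<le> F S (\<lambda>j. p j i)" by (rule order_trans[OF measure_nonneg])
    then show ?thesis by (simp add: p_def)
  qed
  have "prob {\<omega> \<in> space N. \<forall>j\<in>?S. A ?L \<omega> (map (offer L d W) [0..<Suc j]) \<noteq> i} \<le> run ?q ?I n 0"
  proof (cases "?S = {}")
    case True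
    \<comment> \<open>\<open>F\<close> at the empty set gives no information, but here the state is
      \<open>f\<close>, and \<open>f 0 = 1\<close> bounds any probability.\<close>
    then show ?thesis by (simp add: run_disjoint f_0)
  next
    case False
    have "F (?S \<union> {n..<n}) ?q \<le> run ?q ?I n (\<Sum>j=n..<n. ?q j)"
      by (rule OCS_bound_le_run[OF F(2,3) nonneg]) (use q False in auto)
    moreover have "prob {\<omega> \<in> space N. \<forall>j\<in>?S. A ?L \<omega> (map (offer L d W) [0..<Suc j]) \<noteq> i} \<le> F ?S ?q"
      by (rule win) (rule offer)
    ultimately show ?thesis by simp
  qed
  moreover have "{\<omega> \<in> space N. \<forall>j\<in>?S. A ?L \<omega> (map (offer L d W) [0..<Suc j]) \<noteq> i} =
      {\<omega> \<in> space N. \<forall>j<n. u \<le> W j i \<longrightarrow> A ?L \<omega> (map (offer L d W) [0..<Suc j]) \<noteq> i}" by auto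
  ultimately show ?thesis by (simp add: profiles_eq_run)
qed

section \<open>The expected value of the algorithm\<close>

definition best :: "('a \<Rightarrow> real) list \<Rightarrow> 'a \<Rightarrow> 'w \<Rightarrow> real" where
  "best ws i \<omega> = Max (insert 0 {(ws ! j) i | j. j < length ws \<and> assign \<omega> (take (Suc j) ws) = Some i})"

lemma finite_best: "finite {(ws ! j) i | j. j < length ws \<and> assign \<omega> (take (Suc j) ws) = Some i}"
  by (rule finite_subset[of _ "(\<lambda>j. (ws ! j) i) ` {..<length ws}"]) auto

lemma best_nonneg: "0 \<le> best ws i \<omega>"
  unfolding best_def by (rule Max_ge) (use finite_best[of ws i \<omega>] in auto)

lemma le_best_iff:
  assumes "0 < u"
  shows "u \<le> best ws i \<omega> \<longleftrightarrow> (\<exists>j<length ws. u \<le> (ws ! j) i \<and> assign \<omega> (take (Suc j) ws) = Some i)"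
  unfolding best_def using finite_best[of ws i \<omega>] assms
  by (subst Max_ge_iff) auto

lemma assign_event:
  assumes "j < length ws" "i \<in> L"
  shows "{\<omega> \<in> space N. assign \<omega> (take (Suc j) ws) = Some i} \<in> events"
proof -
  have "take (Suc j) ws \<noteq> []" using assms(1) by auto
  from measurable_sets[OF assign_measurable[OF this], of "{Some i}"] assms(2) show ?thesis
    by (simp add: vimage_def Int_def conj_commute)
qed

lemma best_le_event:
  assumes "i \<in> L"
  shows "{\<omega> \<in> space N. u \<le> best ws i \<omega>} \<in> events"
proof (cases "0 < u")
  case True
  have "{\<omega> \<in> space N. u \<le> best ws i \<omega>} =
      (\<Union>j\<in>{j. j < length ws \<and> u \<le> (ws ! j) i}. {\<omega> \<in> space N. assign \<omega> (take (Suc j) ws) = Some i})"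
    by (auto simp: le_best_iff[OF True])
  also have "\<dots> \<in> events" using assign_event assms by (intro sets.finite_UN) auto
  finally show ?thesis .
next
  case False
  then have "{\<omega> \<in> space N. u \<le> best ws i \<omega>} = space N"
    using best_nonneg by (auto intro: order_trans[of u 0])
  then show ?thesis by simp
qed

lemma best_integrable:
  assumes "i \<in> L"
  shows "integrable N (best ws i)"
proof (rule integrable_const_bound)
  show "best ws i \<in> borel_measurable N"
    using best_le_event[OF assms] by (simp add: borel_measurable_iff_ge)
  have "\<bar>best ws i \<omega>\<bar> \<le> (\<Sum>j<length ws. \<bar>(ws ! j) i\<bar>)" for \<omega>
  proof -
    have "best ws i \<omega> \<le> (\<Sum>j<length ws. \<bar>(ws ! j) i\<bar>)"
      unfolding best_def using finite_best[of ws i \<omega>]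
    proof (subst Max_le_iff)
      have "(ws ! j) i \<le> (\<Sum>j<length ws. \<bar>(ws ! j) i\<bar>)" if "j < length ws" for j
        using member_le_sum[of j "{..<length ws}" "\<lambda>j. \<bar>(ws ! j) i\<bar>"] that by auto
      then show "\<forall>a\<in>insert 0 {(ws ! j) i |j. j < length ws \<and> assign \<omega> (take (Suc j) ws) = Some i}.
          a \<le> (\<Sum>j<length ws. \<bar>(ws ! j) i\<bar>)" by (auto simp: sum_nonneg)
    qed auto
    then show ?thesis using best_nonneg[of ws i \<omega>] by simp
  qed
  then show "AE \<omega> in N. norm (best ws i \<omega>) \<le> (\<Sum>j<length ws. \<bar>(ws ! j) i\<bar>)" by simp
qed

lemma won_le_expectation:
  assumes "i \<in> L"
  shows "won (profiles L d (nth ws) (length ws) i) \<le> expectation (best ws i)"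
  unfolding won_def
proof (rule integral_le_expectation[OF best_integrable[OF assms] best_nonneg])
  let ?H = "profiles L d (nth ws) (length ws) i"
  have H: "profile ?H" by (rule profile_profiles[OF finite_L d])
  show "set_integrable lborel {0<..} (\<lambda>u. 1 - ?H u 0)" by (rule integrable_won[OF H])
  show "0 \<le> 1 - ?H u 0" for u using goodD(3)[OF profile_good[OF H, of u]] by simp
  show "1 - ?H u 0 \<le> prob {\<omega> \<in> space N. u \<le> best ws i \<omega>}" if "0 < u" for u
  proof -
    have "space N - {\<omega> \<in> space N. u \<le> best ws i \<omega>} =
        {\<omega> \<in> space N. \<forall>j<length ws. u \<le> (ws ! j) i \<longrightarrow>
          A (insert d L) \<omega> (map (offer L d (nth ws)) [0..<Suc j]) \<noteq> i}"
      using assign_take_iff[OF _ assms, of _ ws] by (auto simp: le_best_iff[OF that] simp del: upt_Suc)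
    then have "prob (space N - {\<omega> \<in> space N. u \<le> best ws i \<omega>}) \<le> ?H u 0"
      using never_wins_le[OF assms, of "length ws" u "nth ws"] by (simp del: upt_Suc)
    then show ?thesis
      using prob_compl[OF best_le_event[OF assms, of u ws]] by simp
  qed
qed

lemma free_disposal_value_ge:
  assumes ws: "set ws \<subseteq> weight_vectors L"
  shows "exp_drop f * opt_matching_weight L ws \<le> (\<integral>\<omega>. free_disposal_value L (assign \<omega>) ws \<partial>N)"
proof -
  let ?Es = "{E. bip_matching L (length ws) E}"
  have "?Es \<subseteq> Pow (L \<times> {..<length ws})" by (auto simp: bip_matching_def)
  then have "finite ?Es" using finite_L by (auto intro: finite_subset)
  moreover have "{} \<in> ?Es" by (simp add: bip_matching_def)
  ultimately have "opt_matching_weight L ws \<in> (\<lambda>E. \<Sum>(i, j)\<in>E. (ws ! j) i) ` ?Es"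
    unfolding opt_matching_weight_def by (intro Max_in) auto
  then obtain E where E: "bip_matching L (length ws) E" "opt_matching_weight L ws = (\<Sum>(i, j)\<in>E. (ws ! j) i)"
    by auto
  have "exp_drop f * opt_matching_weight L ws \<le> (\<Sum>i\<in>L. won (profiles L d (nth ws) (length ws) i))"
    unfolding E(2)
  proof (rule matching_weight_le_won[OF finite_L d E(1)])
    show "0 \<le> (ws ! j) i" if "j < length ws" "i \<in> L" for j i
    proof -
      have "ws ! j \<in> weight_vectors L" using ws nth_mem[OF that(1)] by blast
      then show ?thesis using that(2) by (simp add: weight_vectors_def)
    qed
  qed
  also have "\<dots> \<le> (\<Sum>i\<in>L. expectation (best ws i))"
    by (intro sum_mono won_le_expectation)
  also have "\<dots> = expectation (\<lambda>\<omega>. \<Sum>i\<in>L. best ws i \<omega>)"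
    by (rule Bochner_Integration.integral_sum[symmetric]) (rule best_integrable)
  also have "\<dots> = expectation (\<lambda>\<omega>. free_disposal_value L (assign \<omega>) ws)"
    by (simp add: free_disposal_value_def best_def)
  finally show ?thesis .
qed

end

theorem mainTheorem4:
  fixes f f' f'' f''' :: "real \<Rightarrow> real" and r \<Gamma> :: real
  assumes range_f: "\<And>x. x \<ge> 0 \<Longrightarrow> f x \<in> {0..1}"
    and deriv1: "\<And>x. x \<ge> 0 \<Longrightarrow> (f has_real_derivative f' x) (at x within {0..})"
    and deriv2: "\<And>x. x \<ge> 0 \<Longrightarrow> (f' has_real_derivative f'' x) (at x within {0..})"
    and deriv3: "\<And>x. x \<ge> 0 \<Longrightarrow> (f'' has_real_derivative f''' x) (at x within {0..})"
    and convex_f: "convex_on {0..} f"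
    and log_concave: "\<And>x. x \<ge> 0 \<Longrightarrow> f''' x * f' x \<le> (f'' x)\<^sup>2"
    and lim_f: "(f \<longlongrightarrow> 0) at_top"
    and Gamma_eq: "\<Gamma> = 1 - integral {0..} (\<lambda>t. exp (- t) * f t)"
    and r_nonneg: "r \<ge> 0"
    and r_le: "r \<le> (- f' 0 - \<Gamma>) / (\<Gamma> + (1 - \<Gamma>) * f' 0)"
    and OCS: "\<exists>(M :: 'a::infinite set \<Rightarrow> 'w measure) A. fr_continuous_OCS f r M A"
  shows "\<exists>(M :: 'a set \<Rightarrow> 'w measure) B. competitive_matching_algorithm \<Gamma> M B"
proof -
  obtain M :: "'a set \<Rightarrow> 'w measure" and A where A: "fr_continuous_OCS f r M A" using OCS by blast
  \<comment> \<open>The OCS itself forces the normalisation on which both locales rest.\<close>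
  have f_0: "f 0 = 1"
    using fr_continuous_OCS_f_0[OF A] range_f[of 0] by simp
  interpret log_concave_rate f f' f'' f'''
    by unfold_locales (use assms f_0 in auto)
  have \<Gamma>: "\<Gamma> = exp_drop f"
    using Gamma_eq f_0 by (simp add: exp_drop_def exp_mean_def)
  interpret ocs_rate f r "- f' 0"
    by (rule ocs_rate[OF r_nonneg r_le[unfolded \<Gamma>]])
  \<comment> \<open>In an infinite type every finite \<open>L\<close> leaves room for a dummy
    element.\<close>
  define d :: "'a set \<Rightarrow> 'a" where "d L = (SOME x. x \<notin> L)" for L
  have d: "d L \<notin> L" if "finite L" for L
    unfolding d_def using ex_new_if_finite[OF infinite_UNIV that] by (rule someI_ex)
  have matching: "ocs_matching f r (- f' 0) M A L (d L)" if "finite L" for L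
    by unfold_locales (use A d that in auto)
  have "competitive_matching_algorithm \<Gamma> (\<lambda>L. M (insert (d L) L))
      (\<lambda>L. ocs_matching.assign f r A L (d L))"
    unfolding competitive_matching_algorithm_def online_matching_algorithm_def \<Gamma>
  proof (intro conjI allI impI)
    fix L :: "'a set" and ws :: "('a \<Rightarrow> real) list"
    assume L: "finite L"
    interpret m: ocs_matching f r "- f' 0" M A L "d L" by (rule matching[OF L])
    show "prob_space (M (insert (d L) L))" by (rule m.prob_space_axioms)
    show "(\<lambda>\<omega>. m.assign \<omega> ws) \<in> M (insert (d L) L) \<rightarrow>\<^sub>M count_space (insert None (Some ` L))"
      if "ws \<noteq> [] \<and> set ws \<subseteq> weight_vectors L"
      by (rule m.assign_measurable) (use that in simp)
  next
    fix L :: "'a set" and ws :: "('a \<Rightarrow> real) list"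
    assume L: "finite L \<and> set ws \<subseteq> weight_vectors L"
    interpret m: ocs_matching f r "- f' 0" M A L "d L" by (rule matching) (use L in simp)
    show "exp_drop f * opt_matching_weight L ws \<le>
        (\<integral>\<omega>. free_disposal_value L (m.assign \<omega>) ws \<partial>M (insert (d L) L))"
      by (rule m.free_disposal_value_ge) (use L in simp)
  qed
  then show ?thesis by blast
qed

end
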